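(* Let $F(x)=f(x)+\delta_C(x)+\Phi(|x|)$ be as in the context, and let $\{\theta_k\}_{k\ge 0}\subset(0,1]$ be chosen so that for some $\gamma\in(0,1)$, $$\sup_{k\ge 1}\max\left\{\frac{\theta_k^2(1-\theta_{k-1})^2}{\gamma}-\theta_{k-1}^2,\ \frac{\theta_k^2}{1-\gamma}-1\right\}<0.$$ Suppose that the function $H_3:\mathbb{R}^n\times\mathbb{R}^n\times\mathbb{R}^n\to(-\infty,\infty]$, $$H_3(x,y,w):=f(x)+\delta_C(x)+\Phi(|x|)+\frac{L}{2}\|w-y\|^2+\frac{L}{2}\|w-x\|^2,$$ is a KL function and that $\phi'_+$ is Lipschitz continuous (on $[0,\infty)$). Let $\{x^k\}$ be the sequence generated by the algorithm IRL$_1e_3$ described in the context. Then $\sum_{k=1}^\infty\|x^k-x^{k-1}\|<\infty$ and $\{x^k\}$ converges to a stationary point of the problem $\min_{x\in\mathbb{R}^n}F(x)$, i.e., to a point $\bar x$ with $0\in\partial F(\bar x)$.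
   Context: Setting. $\mathbb{R}^n$ carries the Euclidean inner product $\langle\cdot,\cdot\rangle$ and norm $\|\cdot\|$. The function $f:\mathbb{R}^n\to\mathbb{R}$ is convex and continuously differentiable, and its gradient is Lipschitz continuous with modulus $L>0$. $C\subseteq\mathbb{R}^n$ is a nonempty closed convex set and $\delta_C$ is its indicator function ($0$ on $C$, $+\infty$ off $C$). $\Phi(y)=\sum_{i=1}^n\phi(y_i)$ for $y\in\mathbb{R}^n_+$, where $\phi:\mathbb{R}_+\to\mathbb{R}_+$ is a continuous concave function with $\phi(0)=0$ that is continuously differentiable on $(0,\infty)$ and such that the limit $\ell:=\lim_{t\downarrow 0}\phi'(t)$ exists (as a finite real number). For $x\in\mathbb{R}^n$, $|x|$ is the vector with entries $|x_i|$. It is assumed that $F(x):=f(x)+\delta_C(x)+\Phi(|x|)$ is level-bounded (all sets $\{x: F(x)\le\alpha\}$, $\alpha\in\mathbb{R}$, are bounded). Notation. $\phi'_+(t):=\lim_{h\downarrow 0}\frac{\phi(t+h)-\phi(t)}{h}$ is the right-hand derivative, and $\Phi'_+(|y|):=(\phi'_+(|y_1|),\dots,\phi'_+(|y_n|))$. For a proper function $g$ and $x$ with $g(x)<\infty$, the regular subdifferential is $\hat\partial g(x)=\{\zeta:\liminf_{z\to x,z\ne x}\frac{g(z)-g(x)-\langle\zeta,z-x\rangle}{\|z-x\|}\ge 0\}$, and $\partial g(x)$ is the limiting subdifferential: the set of $\zeta$ for which there exist $x^k\to x$ with $g(x^k)\to g(x)$ and $\zeta^k\in\hat\partial g(x^k)$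 with $\zeta^k\to\zeta$; $\partial g(x)=\emptyset$ if $g(x)=\infty$. $\mathrm{dom}\,\partial g:=\{x:\partial g(x)\ne\emptyset\}$. Distances to sets are Euclidean, with $\mathrm{dist}(x,\emptyset)=\infty$. KL functions. For $a\in(0,\infty]$, $\Xi_a$ is the set of all concave continuous functions $\varphi:[0,a)\to\mathbb{R}_+$ that are continuously differentiable on $(0,a)$ with positive derivatives and satisfy $\varphi(0)=0$. A proper closed (i.e., lower semicontinuous) function $h$ satisfies the KL property at $\hat x\in\mathrm{dom}\,\partial h$ if there exist $a\in(0,\infty]$, a neighborhood $V$ of $\hat x$ and $\varphi\in\Xi_a$ such that $\varphi'(h(x)-h(\hat x))\,\mathrm{dist}(0,\partial h(x))\ge 1$ for every $x\in V$ with $h(\hat x)<h(x)<h(\hat x)+a$. $h$ is a KL function if it satisfies the KL property at every point of $\mathrm{dom}\,\partial h$. Algorithm IRL$_1e_3$. Start with $x^0,z^0\in C$ and $\{\theta_k\}\subset(0,1]$. For $k=0,1,2,\dots$ (run without termination) set $s^{k+1}=\Phi'_+(|x^k|)$, $y^k=(1-\theta_k)x^k+\theta_kz^k$, let $z^{k+1}$ be the unique minimizer over $x\in C$ of $\langle\nabla f(y^k),x-y^k\rangle+\frac{L\theta_k}{2}\|x-z^k\|^2+\sum_{i=1}^n s^{k+1}_i|x_i|$, and let $x^{k+1}$ be the unique minimizer over $y\in C$ of $\langle\nabla f(y^k),y-y^k\rangle+\frac{L}{2}\|y-y^k\|^2+\sum_{i=1}^n s^{k+1}_i|y_i|$. 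*)

theory Defs
  imports "HOL-Analysis.Analysis"
begin

definition indicator_fun :: "'a set \<Rightarrow> 'a \<Rightarrow> ereal" where
  "indicator_fun C x = (if x \<in> C then 0 else \<infinity>)"

definition proper_fun :: "('a \<Rightarrow> ereal) \<Rightarrow> bool" where
  "proper_fun g \<longleftrightarrow> (\<forall>x. g x \<noteq> - \<infinity>) \<and> (\<exists>x. g x < \<infinity>)"

definition lsc_fun :: "('a::topological_space \<Rightarrow> ereal) \<Rightarrow> bool" where
  "lsc_fun g \<longleftrightarrow> (\<forall>x. g x \<le> Liminf (at x) g)"

text \<open>The subdifferentials below are meant for functions that never take the value
  \<open>-\<infinity>\<close>, so that with \<open>g x < \<infinity>\<close> the difference \<open>g z - g x\<close> is never
  an undetermined form.\<close>

definition regular_subdiff :: "('a::real_inner \<Rightarrow> ereal) \<Rightarrow> 'a \<Rightarrow> 'a set" where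
  "regular_subdiff g x =
    {\<zeta>. g x < \<infinity> \<and>
      Liminf (at x) (\<lambda>z. (g z - g x - ereal (\<zeta> \<bullet> (z - x))) / ereal (norm (z - x))) \<ge> 0}"

definition limiting_subdiff :: "('a::real_inner \<Rightarrow> ereal) \<Rightarrow> 'a \<Rightarrow> 'a set" where
  "limiting_subdiff g x =
    {\<zeta>. g x < \<infinity> \<and>
      (\<exists>(xs :: nat \<Rightarrow> 'a) (\<zeta>s :: nat \<Rightarrow> 'a). xs \<longlonglongrightarrow> x \<and> (\<lambda>k. g (xs k)) \<longlonglongrightarrow> g x \<and>
        (\<forall>k. \<zeta>s k \<in> regular_subdiff g (xs k)) \<and> \<zeta>s \<longlonglongrightarrow> \<zeta>)}"

definition dom_subdiff :: "('a::real_inner \<Rightarrow> ereal) \<Rightarrow> 'a set" where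
  "dom_subdiff g = {x. limiting_subdiff g x \<noteq> {}}"

text \<open>Unlike \<^const>\<open>infdist\<close>, this distance to the empty set is \<open>\<infinity>\<close>.\<close>

definition edist_set :: "'a::metric_space \<Rightarrow> 'a set \<Rightarrow> ereal" where
  "edist_set x S = (INF v\<in>S. ereal (dist x v))"

definition Xi :: "ereal \<Rightarrow> (real \<Rightarrow> real) set" where
  "Xi a = {\<phi>. concave_on {t. 0 \<le> t \<and> ereal t < a} \<phi> \<and>
              continuous_on {t. 0 \<le> t \<and> ereal t < a} \<phi> \<and>
              (\<forall>t. 0 \<le> t \<and> ereal t < a \<longrightarrow> 0 \<le> \<phi> t) \<and>
              \<phi> C1_differentiable_on {t. 0 < t \<and> ereal t < a} \<and>
              (\<forall>t. 0 < t \<and> ereal t < a \<longrightarrow> 0 < deriv \<phi> t) \<and>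
              \<phi> 0 = 0}"

definition KL_property_at :: "('a::real_inner \<Rightarrow> ereal) \<Rightarrow> 'a \<Rightarrow> bool" where
  "KL_property_at h x0 \<longleftrightarrow>
    (\<exists>a V \<phi>. 0 < a \<and> open V \<and> x0 \<in> V \<and> \<phi> \<in> Xi a \<and>
      (\<forall>x\<in>V. h x0 < h x \<and> h x < h x0 + a \<longrightarrow>
        ereal (deriv \<phi> (real_of_ereal (h x - h x0))) * edist_set 0 (limiting_subdiff h x) \<ge> 1))"

definition KL_function :: "('a::real_inner \<Rightarrow> ereal) \<Rightarrow> bool" where
  "KL_function h \<longleftrightarrow>
    proper_fun h \<and> lsc_fun h \<and> (\<forall>x\<in>dom_subdiff h. KL_property_at h x)"

definition right_deriv :: "(real \<Rightarrow> real) \<Rightarrow> real \<Rightarrow> real" where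
  "right_deriv \<phi> t = Lim (at_right 0) (\<lambda>h. (\<phi> (t + h) - \<phi> t) / h)"

definition Phi :: "(real \<Rightarrow> real) \<Rightarrow> real ^ 'n \<Rightarrow> real" where
  "Phi \<phi> y = (\<Sum>i\<in>UNIV. \<phi> (y $ i))"

text \<open>On \<^typ>\<open>real ^ 'n\<close> the absolute value \<open>\<bar>x\<bar>\<close> is taken componentwise.\<close>

definition F_obj ::
  "(real ^ 'n \<Rightarrow> real) \<Rightarrow> (real ^ 'n) set \<Rightarrow> (real \<Rightarrow> real) \<Rightarrow> real ^ 'n \<Rightarrow> ereal" where
  "F_obj f C \<phi> x = ereal (f x) + indicator_fun C x + ereal (Phi \<phi> \<bar>x\<bar>)"

definition H3 ::
  "real \<Rightarrow> (real ^ 'n \<Rightarrow> real) \<Rightarrow> (real ^ 'n) set \<Rightarrow> (real \<Rightarrow> real)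
    \<Rightarrow> (real ^ 'n) \<times> (real ^ 'n) \<times> (real ^ 'n) \<Rightarrow> ereal" where
  "H3 L f C \<phi> = (\<lambda>(x, y, w).
     ereal (f x) + indicator_fun C x + ereal (Phi \<phi> \<bar>x\<bar>)
       + ereal (L / 2 * (norm (w - y))\<^sup>2) + ereal (L / 2 * (norm (w - x))\<^sup>2))"

text \<open>The argument \<open>gf\<close> is the gradient of \<open>f\<close>. A nonnegative concave \<open>\<phi>\<close>
  is nondecreasing on \<open>[0,\<infinity>)\<close>, so the weights \<open>s (Suc k)\<close> are nonnegative, both objectives are
  strongly convex, and the minimizers over the closed convex set \<open>C\<close> are unique.
  The initial weight \<open>s 0\<close> is never used.\<close>

definition IRL1e3 ::
  "real \<Rightarrow> (real ^ 'n \<Rightarrow> real ^ 'n) \<Rightarrow> (real ^ 'n) set \<Rightarrow> (real \<Rightarrow> real) \<Rightarrow> (nat \<Rightarrow> real)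
    \<Rightarrow> (nat \<Rightarrow> real ^ 'n) \<Rightarrow> (nat \<Rightarrow> real ^ 'n) \<Rightarrow> (nat \<Rightarrow> real ^ 'n) \<Rightarrow> (nat \<Rightarrow> real ^ 'n) \<Rightarrow> bool"
  where
  "IRL1e3 L gf C \<phi> \<theta> s y z x \<longleftrightarrow>
     x 0 \<in> C \<and> z 0 \<in> C \<and>
     (\<forall>k. s (Suc k) = (\<chi> i. right_deriv \<phi> \<bar>x k $ i\<bar>) \<and>
          y k = (1 - \<theta> k) *\<^sub>R x k + \<theta> k *\<^sub>R z k \<and>
          is_arg_min
            (\<lambda>u. gf (y k) \<bullet> (u - y k) + L * \<theta> k / 2 * (norm (u - z k))\<^sup>2
                  + (\<Sum>i\<in>UNIV. s (Suc k) $ i * \<bar>u $ i\<bar>))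
            (\<lambda>u. u \<in> C) (z (Suc k)) \<and>
          is_arg_min
            (\<lambda>u. gf (y k) \<bullet> (u - y k) + L / 2 * (norm (u - y k))\<^sup>2
                  + (\<Sum>i\<in>UNIV. s (Suc k) $ i * \<bar>u $ i\<bar>))
            (\<lambda>u. u \<in> C) (x (Suc k)))"

end

theory Submission
  imports Defs
begin

text \<open>
  The algorithm is an accelerated majorization method whose objective need not decrease
  monotonically. What does decrease is the value of \<^const>\<open>H3\<close> along the triples
  \<open>(x (Suc k), x k, w k)\<close> with \<open>w k = (1 - \<theta> k) *\<^sub>R x k + \<theta> k *\<^sub>R z (Suc k)\<close>. Concavity of
  the penalty makes the weighted absolute values a majorant, and the strong convexity of the two
  proximal subproblems yields \<open>accelerated_descent\<close>: the value of \<^const>\<open>H3\<close> at the new triple exceeds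
  the objective at \<open>x k\<close> by at most a multiple of the squared norm of \<open>\<theta> k *\<^sub>R (x k - z k)\<close>.
  The condition on the parameters is what keeps this excess below the two quadratic terms of the
  preceding value of \<^const>\<open>H3\<close>, with a margin proportional to \<open>(gap k)\<^sup>2\<close> (\<open>extrapolation_bound\<close>).
  Hence the value of \<^const>\<open>H3\<close> falls by a multiple of \<open>(gap k)\<^sup>2\<close> in each step
  (\<open>potential_descent\<close>), where \<open>gap k\<close> dominates the step length.

  For the Kurdyka-Lojasiewicz inequality a small subgradient is needed at each triple. It is written
  down explicitly in terms of the iterates (\<open>residual_subgradient\<close>, \<open>residual3_in_subdiff\<close>); the weights
  used in the \<open>x\<close>-step belong to the previous iterate, and the Lipschitz continuity of the
  right-hand derivative turns this mismatch into an error of the size of the step. Its norm is at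
  most a multiple of \<open>gap k + gap (Suc k)\<close> for the triple of index \<open>Suc k\<close>.

  Descent, subgradient bound and KL inequality at a cluster point together give a finite sum of gaps
  (\<open>KL_finite_length\<close>). The iterates therefore have finite length and converge, and the vanishing
  subgradients make the limit stationary.
\<close>

section \<open>Smooth convex functions\<close>

lemma GDERIV_along_line:
  fixes f :: "'a::real_inner \<Rightarrow> real"
  assumes "\<And>v. GDERIV f v :> gf v"
  shows "((\<lambda>t. f (y + t *\<^sub>R d)) has_real_derivative gf (y + t *\<^sub>R d) \<bullet> d) (at t)"
proof -
  have "(f has_derivative (\<lambda>h. h \<bullet> gf (y + t *\<^sub>R d))) (at (y + t *\<^sub>R d))"
    using assms unfolding gderiv_def by blast
  moreover have "((\<lambda>t. y + t *\<^sub>R d) has_derivative (\<lambda>h. h *\<^sub>R d)) (at t)"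
    by (auto intro!: derivative_eq_intros)
  ultimately have "(f \<circ> (\<lambda>t. y + t *\<^sub>R d) has_derivative
      (\<lambda>h. h \<bullet> gf (y + t *\<^sub>R d)) \<circ> (\<lambda>h. h *\<^sub>R d)) (at t)"
    by (intro diff_chain_at)
  then show ?thesis
    by (simp add: has_field_derivative_def o_def inner_commute mult_commute_abs)
qed

text \<open>Along the segment from \<open>y\<close> to \<open>u\<close> the difference of the two sides has a nonpositive derivative.
  The plain mean value theorem would only give the constant \<open>L\<close> instead of \<open>L / 2\<close>, and the descent
  estimate has no room for that loss.\<close>

lemma lipschitz_gradient_upper_bound:
  fixes f :: "'a::real_inner \<Rightarrow> real"
  assumes grad: "\<And>v. GDERIV f v :> gf v" and lip: "L-lipschitz_on UNIV gf"
  shows "f u \<le> f y + gf y \<bullet> (u - y) + L / 2 * (norm (u - y))\<^sup>2"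
proof -
  let ?d = "u - y"
  let ?h = "\<lambda>t. f (y + t *\<^sub>R ?d) - t * (gf y \<bullet> ?d) - L / 2 * t\<^sup>2 * (norm ?d)\<^sup>2"
  have "?h 1 \<le> ?h 0"
  proof (rule DERIV_nonpos_imp_nonincreasing[of 0 1 ?h])
    fix t :: real
    assume t: "0 \<le> t" "t \<le> 1"
    let ?v = "y + t *\<^sub>R ?d"
    have "(?h has_real_derivative (gf ?v \<bullet> ?d - gf y \<bullet> ?d - L * t * (norm ?d)\<^sup>2)) (at t)"
      by (auto intro!: derivative_eq_intros GDERIV_along_line[OF grad])
    moreover have "gf ?v \<bullet> ?d - gf y \<bullet> ?d \<le> L * t * (norm ?d)\<^sup>2"
    proof -
      have "gf ?v \<bullet> ?d - gf y \<bullet> ?d \<le> norm (gf ?v - gf y) * norm ?d"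
        by (metis inner_diff_left norm_cauchy_schwarz)
      also have "norm (gf ?v - gf y) \<le> L * (t * norm ?d)"
        using lipschitz_onD[OF lip, of ?v y] t by (simp add: dist_norm)
      finally show ?thesis
        by (simp add: power2_eq_square mult_right_mono mult.assoc)
    qed
    ultimately show "\<exists>D. (?h has_real_derivative D) (at t) \<and> D \<le> 0"
      by (intro exI[of _ "gf ?v \<bullet> ?d - gf y \<bullet> ?d - L * t * (norm ?d)\<^sup>2"]) auto
  qed simp
  then show ?thesis
    by simp
qed

lemma convex_gradient_inequality:
  fixes f :: "'a::real_inner \<Rightarrow> real"
  assumes grad: "\<And>v. GDERIV f v :> gf v" and conv: "convex_on UNIV f"
  shows "f y + gf y \<bullet> (u - y) \<le> f u"
proof -
  let ?g = "\<lambda>t. f (y + t *\<^sub>R (u - y))"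
  have "convex_on UNIV ?g"
  proof (rule convex_onI)
    fix a s t :: real
    assume a: "0 < a" "a < 1"
    have eq: "y + ((1 - a) *\<^sub>R s + a *\<^sub>R t) *\<^sub>R (u - y)
        = (1 - a) *\<^sub>R (y + s *\<^sub>R (u - y)) + a *\<^sub>R (y + t *\<^sub>R (u - y))"
      by (simp add: algebra_simps)
    show "?g ((1 - a) *\<^sub>R s + a *\<^sub>R t) \<le> (1 - a) * ?g s + a * ?g t"
      unfolding eq by (rule convex_onD[OF conv]) (use a in auto)
  qed simp
  moreover have "(?g has_real_derivative gf y \<bullet> (u - y)) (at 0)"
    using GDERIV_along_line[OF grad, of y "u - y" 0] by simp
  ultimately have "?g 1 - ?g 0 \<ge> gf y \<bullet> (u - y) * (1 - 0)"
    using convex_on_imp_above_tangent[of UNIV ?g 0 1] by simp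
  then show ?thesis
    by simp
qed

section \<open>Proximal steps\<close>

lemma norm_add_square:
  fixes a b :: "'a::real_inner"
  shows "(norm (a + b))\<^sup>2 = (norm a)\<^sup>2 + 2 * (a \<bullet> b) + (norm b)\<^sup>2"
  by (simp add: power2_norm_eq_inner inner_add_left inner_add_right inner_commute[of b a])
text \<open>First-order optimality without subdifferentials: the minimizer is compared with points of the
  segment towards \<open>u\<close>, and the difference quotient tends to the right-hand side. Keeping the
  increment of \<open>P\<close>, rather than choosing a subgradient of it, avoids a sum rule for \<open>P\<close> and the
  normal cone of \<open>C\<close>.\<close>

lemma prox_variational_inequality:
  fixes P :: "'a::real_inner \<Rightarrow> real"
  assumes P: "convex_on C P"
    and min: "is_arg_min (\<lambda>u. a \<bullet> (u - b) + \<mu> / 2 * (norm (u - c))\<^sup>2 + P u) (\<lambda>u. u \<in> C) p"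
    and u: "u \<in> C"
  shows "0 \<le> (a + \<mu> *\<^sub>R (p - c)) \<bullet> (u - p) + P u - P p"
proof -
  let ?X = "(a + \<mu> *\<^sub>R (p - c)) \<bullet> (u - p) + P u - P p"
  let ?Y = "\<mu> / 2 * (norm (u - p))\<^sup>2"
  have p: "p \<in> C"
    using min by (simp add: is_arg_min_def)
  have bound: "0 \<le> ?X + t * ?Y" if t: "0 < t" "t < 1" for t
  proof -
    let ?w = "(1 - t) *\<^sub>R p + t *\<^sub>R u"
    have "?w \<in> C"
      using P p u t by (auto simp: convex_on_def convex_def)
    then have "a \<bullet> (p - b) + \<mu> / 2 * (norm (p - c))\<^sup>2 + P p
        \<le> a \<bullet> (?w - b) + \<mu> / 2 * (norm (?w - c))\<^sup>2 + P ?w"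
      using min by (auto simp: is_arg_min_linorder)
    also have "P ?w \<le> (1 - t) * P p + t * P u"
      using convex_onD[OF P, of t p u] p u t by simp
    finally have le: "a \<bullet> (p - b) + \<mu> / 2 * (norm (p - c))\<^sup>2 + P p
        \<le> a \<bullet> (?w - b) + \<mu> / 2 * (norm (?w - c))\<^sup>2 + ((1 - t) * P p + t * P u)"
      by simp
    have w: "?w - c = (p - c) + t *\<^sub>R (u - p)" "?w - b = (p - b) + t *\<^sub>R (u - p)"
      by (simp_all add: algebra_simps)
    have "(norm (?w - c))\<^sup>2 = (norm (p - c))\<^sup>2 + 2 * t * ((p - c) \<bullet> (u - p))
        + t\<^sup>2 * (norm (u - p))\<^sup>2"
      unfolding w norm_add_square by (simp add: power_mult_distrib)
    moreover have "a \<bullet> (?w - b) = a \<bullet> (p - b) + t * (a \<bullet> (u - p))"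
      unfolding w by (simp add: inner_add_right)
    moreover have ring: "0 \<le> t * (A + \<mu> * I + Q - R + t * (\<mu> / 2 * U))"
      if "B + \<mu> / 2 * N + R \<le> (B + t * A) + \<mu> / 2 * (N + 2 * t * I + t\<^sup>2 * U) + ((1 - t) * R + t * Q)"
      for A B N R I U Q :: real
      using that by (simp add: algebra_simps power2_eq_square)
    ultimately have "0 \<le> t * (a \<bullet> (u - p) + \<mu> * ((p - c) \<bullet> (u - p)) + P u - P p + t * ?Y)"
      using le by (intro ring) simp
    then have "0 \<le> t * (?X + t * ?Y)"
      by (simp only: inner_add_left inner_scaleR_left)
    then show ?thesis
      using t by (simp only: zero_le_mult_iff) linarith
  qed
  have "((\<lambda>t. ?X + t * ?Y) \<longlongrightarrow> ?X + 0 * ?Y) (at_right 0)"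
    by (intro tendsto_intros)
  moreover have "\<forall>\<^sub>F t in at_right 0. 0 \<le> ?X + t * ?Y"
    unfolding eventually_at_right_field using bound by (intro exI[of _ 1]) simp
  ultimately have "0 \<le> ?X + 0 * ?Y"
    by (rule tendsto_lowerbound) simp
  then show ?thesis
    by simp
qed

lemma prox_three_point:
  fixes P :: "'a::real_inner \<Rightarrow> real"
  assumes "convex_on C P"
    and "is_arg_min (\<lambda>u. a \<bullet> (u - b) + \<mu> / 2 * (norm (u - c))\<^sup>2 + P u) (\<lambda>u. u \<in> C) p"
    and "u \<in> C"
  shows "a \<bullet> p + \<mu> / 2 * (norm (p - c))\<^sup>2 + P p + \<mu> / 2 * (norm (u - p))\<^sup>2
    \<le> a \<bullet> u + \<mu> / 2 * (norm (u - c))\<^sup>2 + P u"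
proof -
  have "(norm (u - c))\<^sup>2 = (norm (p - c))\<^sup>2 + 2 * ((p - c) \<bullet> (u - p)) + (norm (u - p))\<^sup>2"
    using norm_add_square[of "p - c" "u - p"] by simp
  then have "\<mu> / 2 * (norm (u - c))\<^sup>2 = \<mu> / 2 * (norm (p - c))\<^sup>2
      + \<mu> * ((p - c) \<bullet> (u - p)) + \<mu> / 2 * (norm (u - p))\<^sup>2"
    by (simp add: distrib_left)
  moreover have "(a + \<mu> *\<^sub>R (p - c)) \<bullet> (u - p)
      = a \<bullet> u - a \<bullet> p + \<mu> * ((p - c) \<bullet> (u - p))"
    by (simp only: inner_add_left inner_scaleR_left inner_diff_right[of a])
  ultimately show ?thesis
    using prox_variational_inequality[OF assms] by linarith
qed

section \<open>Finite length from the Kurdyka-Lojasiewicz inequality\<close>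

lemma concave_below_tangent:
  fixes \<phi> :: "real \<Rightarrow> real"
  assumes "concave_on A \<phi>" "connected A" "c \<in> interior A" "u \<in> A"
    and "(\<phi> has_real_derivative D) (at c)"
  shows "\<phi> u - \<phi> c \<le> D * (u - c)"
proof -
  have "((\<lambda>t. - \<phi> t) has_real_derivative - D) (at c within A)"
    using DERIV_subset[OF DERIV_minus[OF assms(5)] subset_UNIV] .
  then have "- D * (u - c) \<le> - \<phi> u - - \<phi> c"
    using assms(1-4) unfolding concave_on_def
    by (intro convex_on_imp_above_tangent[where f = "\<lambda>t. - \<phi> t" and A = A])
  then show ?thesis
    by simp
qed

text \<open>The finite-length argument for descent methods, in a form where the decrease from \<open>V k\<close> to
  \<open>V (Suc k)\<close> is measured by \<open>D k\<close>, but the subgradient at step \<open>Suc k\<close> is only controlled by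
  \<open>D k + D (Suc k)\<close>. The potential \<open>Q k = D k / 4 + B * \<phi> (V (Suc k) - Vs)\<close> absorbs the
  shift of the index: it drops by at least \<open>D (Suc k) / 2\<close> in each step inside the ball. As its
  total drop is finite and small, a tail that starts close to the cluster point \<open>p\<close> never
  leaves the ball, and the sum of the \<open>D k\<close> telescopes.\<close>

lemma KL_finite_length:
  fixes X :: "nat \<Rightarrow> 'a::metric_space" and V D :: "nat \<Rightarrow> real"
  assumes c: "0 < c" and b: "0 \<le> b" and D: "\<And>k. 0 \<le> D k" and D0: "D \<longlonglongrightarrow> 0"
    and descent: "\<And>k. V (Suc k) + c * (D k)\<^sup>2 \<le> V k" and V: "V \<longlonglongrightarrow> Vs"
    and step: "\<And>k. dist (X (Suc k)) (X k) \<le> D (Suc k)"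
    and r: "strict_mono r" "(X \<circ> r) \<longlonglongrightarrow> p"
    and a: "0 < a" and \<rho>: "0 < \<rho>"
    and concave: "concave_on {0..<a} \<phi>" and cont: "continuous_on {0..<a} \<phi>"
    and nonneg: "\<And>t. 0 \<le> t \<Longrightarrow> t < a \<Longrightarrow> 0 \<le> \<phi> t" and zero: "\<phi> 0 = 0"
    and deriv: "\<And>t. 0 < t \<Longrightarrow> t < a \<Longrightarrow> (\<phi> has_real_derivative \<phi>' t) (at t)"
    and KL: "\<forall>\<^sub>F k in sequentially. dist (X (Suc k)) p < \<rho> \<longrightarrow> Vs < V (Suc k) \<longrightarrow>
      V (Suc k) < Vs + a \<longrightarrow> 1 \<le> \<phi>' (V (Suc k) - Vs) * (b * (D k + D (Suc k)))"
  shows "summable D"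
proof -
  have dec: "decseq V"
    using descent c by (intro decseq_SucI) (smt (verit) mult_nonneg_nonneg zero_le_power2)
  have Vs: "Vs \<le> V k" for k
    using decseq_ge[OF dec V] .
  show ?thesis
  proof (cases "\<exists>k. V k = Vs")
    \<comment> \<open>If the limit value is attained, descent forces all later \<open>D k\<close> to vanish.\<close>
    case True
    then obtain m where m: "V m = Vs"
      by blast
    have "D k = 0" if "m \<le> k" for k
    proof -
      have "V k = Vs"
        using decseqD[OF dec that] Vs[of k] m by simp
      then have "c * (D k)\<^sup>2 \<le> 0"
        using descent[of k] Vs[of "Suc k"] by simp
      then show ?thesis
        using c by (simp add: mult_le_0_iff)
    qed
    then show ?thesis
      by (intro summable_finite[of "{..<m}"]) auto
  next
    case False
    then have pos: "Vs < V k" for k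
      using Vs[of k] by (metis less_le)
    define B where "B = b / c"
    define Q where "Q k = D k / 4 + B * \<phi> (V (Suc k) - Vs)" for k
    have B: "0 \<le> B"
      using b c by (simp add: B_def)
    have V0: "(\<lambda>k. V (Suc k) - Vs) \<longlonglongrightarrow> 0"
      using LIMSEQ_Suc[OF V] by (simp add: LIM_zero)
    then have small: "\<forall>\<^sub>F k in sequentially. V (Suc k) - Vs < a"
      using a by (rule order_tendstoD(2))
    have "(\<lambda>k. \<phi> (V (Suc k) - Vs)) \<longlonglongrightarrow> \<phi> 0"
    proof (rule continuous_on_tendsto_compose[OF cont V0])
      show "\<forall>\<^sub>F k in sequentially. V (Suc k) - Vs \<in> {0..<a}"
        using small by eventually_elim (use Vs in auto)
    qed (use a in auto)
    then have Q0: "Q \<longlonglongrightarrow> 0"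
      unfolding Q_def using D0 zero by (auto intro!: tendsto_eq_intros)
    \<comment> \<open>Inside the ball and the KL range, half of \<open>D (Suc k)\<close> is paid for by a drop of \<open>Q\<close>: concavity
      turns the inequality on the derivative into one on the increments of \<open>\<phi>\<close>, and the
      arithmetic-geometric mean splits the product \<open>(D k + D (Suc k)) * (\<phi> s - \<phi> t)\<close>.\<close>
    have gain: "D (Suc k) / 2 + Q (Suc k) \<le> Q k"
      if "V (Suc k) - Vs < a"
        "1 \<le> \<phi>' (V (Suc k) - Vs) * (b * (D k + D (Suc k)))" for k
    proof -
      define s t where "s = V (Suc k) - Vs" and "t = V (Suc (Suc k)) - Vs"
      have st: "0 < s" "s < a" "0 \<le> t" "t \<le> s"
        using that pos[of "Suc k"] Vs[of "Suc (Suc k)"] decseq_SucD[OF dec, of "Suc k"]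
        by (auto simp: s_def t_def)
      have "\<phi> t - \<phi> s \<le> \<phi>' s * (t - s)"
        using st by (intro concave_below_tangent[OF concave] deriv) (auto simp: interior_atLeastLessThan)
      then have drop: "\<phi>' s * (s - t) \<le> \<phi> s - \<phi> t"
        by (simp add: algebra_simps)
      have one: "1 \<le> \<phi>' s * (b * (D k + D (Suc k)))"
        using that(2) by (simp add: s_def)
      have bD: "0 \<le> b * (D k + D (Suc k))"
        using b D by simp
      have "0 \<le> \<phi>' s"
        using one bD by (smt (verit) mult_nonpos_nonneg)
      have "c * (D (Suc k))\<^sup>2 \<le> s - t"
        using descent[of "Suc k"] by (simp add: s_def t_def)
      also have "s - t \<le> (\<phi>' s * (b * (D k + D (Suc k)))) * (s - t)"
        using mult_right_mono[OF one, of "s - t"] st by simp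
      also have "\<dots> = b * (D k + D (Suc k)) * (\<phi>' s * (s - t))"
        by (simp add: algebra_simps)
      also have "\<dots> \<le> b * (D k + D (Suc k)) * (\<phi> s - \<phi> t)"
        using drop bD by (rule mult_left_mono)
      finally have square: "(D (Suc k))\<^sup>2 \<le> (D k + D (Suc k)) * (B * (\<phi> s - \<phi> t))"
        using c by (simp add: B_def field_simps)
      have nonneg_drop: "0 \<le> B * (\<phi> s - \<phi> t)"
        using B drop \<open>0 \<le> \<phi>' s\<close> st by (smt (verit) mult_nonneg_nonneg)
      have "D (Suc k) \<le> sqrt ((D k + D (Suc k)) / 2 * (2 * (B * (\<phi> s - \<phi> t))))"
        using square by (intro real_le_rsqrt) simp
      also have "\<dots> \<le> ((D k + D (Suc k)) / 2 + 2 * (B * (\<phi> s - \<phi> t))) / 2"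
        using D[of k] D[of "Suc k"] nonneg_drop by (intro arith_geo_mean_sqrt) auto
      also have "\<dots> = (D k + D (Suc k)) / 4 + (B * \<phi> s - B * \<phi> t)"
        by (simp add: right_diff_distrib add_divide_distrib)
      finally have "D (Suc k) / 2 + (D (Suc k) / 4 + B * \<phi> t) \<le> D k / 4 + B * \<phi> s"
        by (simp add: field_simps)
      then show ?thesis
        by (simp add: Q_def s_def t_def)
    qed
    have "\<forall>\<^sub>F k in sequentially. (dist (X (Suc k)) p < \<rho> \<longrightarrow> D (Suc k) / 2 + Q (Suc k) \<le> Q k)
        \<and> D (Suc k) < \<rho> / 2 \<and> 2 * Q k < \<rho> / 4 \<and> 0 \<le> Q k"
    proof -
      have "\<forall>\<^sub>F k in sequentially. D (Suc k) < \<rho> / 2"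
        using order_tendstoD(2)[OF LIMSEQ_Suc[OF D0], of "\<rho> / 2"] \<rho> by simp
      moreover have "\<forall>\<^sub>F k in sequentially. 2 * Q k < \<rho> / 4"
        using order_tendstoD(2)[OF tendsto_mult_right_zero[OF Q0], of "\<rho> / 4" 2] \<rho> by simp
      ultimately show ?thesis
        using KL small
      proof eventually_elim
        case (elim k)
        then show ?case
          using pos[of "Suc k"] gain[of k] nonneg[of "V (Suc k) - Vs"] B D[of k]
            by (auto simp: Q_def algebra_simps intro!: add_nonneg_nonneg)
      qed
    qed
    then obtain K where K: "\<And>k. K \<le> k \<Longrightarrow>
        (dist (X (Suc k)) p < \<rho> \<longrightarrow> D (Suc k) / 2 + Q (Suc k) \<le> Q k)
        \<and> D (Suc k) < \<rho> / 2 \<and> 2 * Q k < \<rho> / 4 \<and> 0 \<le> Q k"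
      unfolding eventually_sequentially by blast
    have "\<forall>\<^sub>F j in sequentially. dist (X (r j)) p < \<rho> / 4"
      using tendstoD[OF r(2), of "\<rho> / 4"] \<rho> by (simp add: o_def)
    moreover have "\<forall>\<^sub>F j in sequentially. K \<le> r j"
      using filterlim_subseq[OF r(1)] by (simp add: filterlim_at_top)
    ultimately have "\<forall>\<^sub>F j in sequentially. dist (X (r j)) p < \<rho> / 4 \<and> K \<le> r j"
      by (rule eventually_conj)
    then obtain N where N: "dist (X N) p < \<rho> / 4" "K \<le> N"
      using eventually_happens trivial_limit_sequentially by blast
    \<comment> \<open>The distance to \<open>p\<close> plus \<open>2 * Q\<close> never increases, so it stays below \<open>\<rho> / 2\<close>; the
      next step is shorter than \<open>\<rho> / 2\<close> and hence still lands in the ball.\<close>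
    have inv: "dist (X n) p + 2 * Q n \<le> dist (X N) p + 2 * Q N
        \<and> D (Suc n) / 2 + Q (Suc n) \<le> Q n" if "N \<le> n" for n
      using that
    proof (induction n rule: dec_induct)
      case base
      have "dist (X (Suc N)) p < \<rho>"
        using step[of N] K[OF N(2)] N(1) dist_triangle[of "X (Suc N)" p "X N"] by linarith
      then show ?case
        using K[OF N(2)] by simp
    next
      case (step n)
      have Kn: "K \<le> n" "K \<le> Suc n"
        using N(2) step.hyps by simp_all
      have le: "dist (X (Suc n)) p + 2 * Q (Suc n) \<le> dist (X N) p + 2 * Q N"
        using step.IH \<open>\<And>k. dist (X (Suc k)) (X k) \<le> D (Suc k)\<close>[of n]
          dist_triangle[of "X (Suc n)" p "X n"] by linarith
      have "0 \<le> Q (Suc n)"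
        using K[OF Kn(2)] by blast
      then have "dist (X (Suc (Suc n))) p < \<rho>"
        using le \<open>\<And>k. dist (X (Suc k)) (X k) \<le> D (Suc k)\<close>[of "Suc n"] K[OF Kn(2)] K[OF N(2)] N(1)
          dist_triangle[of "X (Suc (Suc n))" p "X (Suc n)"] by linarith
      then show ?case
        using le K[OF Kn(2)] by simp
    qed
    have "summable (\<lambda>n. Q n - Q (Suc n))"
      using Q0 by (rule telescope_summable')
    then have "summable (\<lambda>n. 2 * (Q n - Q (Suc n)))"
      by (rule summable_mult)
    then have "summable (\<lambda>n. D (Suc n))"
    proof (rule summable_comparison_test_ev[rotated])
      show "\<forall>\<^sub>F n in sequentially. norm (D (Suc n)) \<le> 2 * (Q n - Q (Suc n))"
        using eventually_ge_at_top[of N]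
      proof eventually_elim
        case (elim n)
        then show ?case
          using inv[of n] D[of "Suc n"] by simp
      qed
    qed
    then show ?thesis
      by (simp add: summable_Suc_iff)
  qed
qed

section \<open>Regular subgradients\<close>

text \<open>Proximal subgradients are regular: a quadratic error is \<open>o(norm (z - x))\<close>. All subgradients
  constructed below are of this kind.\<close>

lemma regular_subdiffI:
  assumes gx: "g x = ereal r"
    and ev: "\<forall>\<^sub>F z in at x. ereal (r + \<zeta> \<bullet> (z - x) - K * (norm (z - x))\<^sup>2) \<le> g z"
  shows "\<zeta> \<in> regular_subdiff g x"
proof -
  let ?q = "\<lambda>z. (g z - g x - ereal (\<zeta> \<bullet> (z - x))) / ereal (norm (z - x))"
  have q: "\<forall>\<^sub>F z in at x. ereal (- K * norm (z - x)) \<le> ?q z"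
    using ev eventually_neq_at_within[of x]
  proof eventually_elim
    case (elim z)
    then have n: "0 < norm (z - x)"
      by simp
    show ?case
    proof (cases "g z")
      case (real t)
      then have "- K * norm (z - x) * norm (z - x) \<le> t - r - \<zeta> \<bullet> (z - x)"
        using elim by (simp add: power2_eq_square algebra_simps)
      then show ?thesis
        using real gx n by (simp add: field_simps)
    qed (use elim gx n in auto)
  qed
  have "((\<lambda>z. - K * norm (z - x)) \<longlongrightarrow> - K * norm (x - x)) (at x)"
    by (intro tendsto_intros)
  then have lim: "((\<lambda>z. ereal (- K * norm (z - x))) \<longlongrightarrow> 0) (at x)"
    by (simp add: zero_ereal_def)
  have "0 \<le> Liminf (at x) ?q"
    unfolding le_Liminf_iff
  proof (intro allI impI)
    fix e :: ereal
    assume "e < 0"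
    then have "\<forall>\<^sub>F z in at x. e < ereal (- K * norm (z - x))"
      using order_tendstoD(1)[OF lim] by blast
    then show "\<forall>\<^sub>F z in at x. e < ?q z"
      using q by eventually_elim (rule less_le_trans)
  qed
  then show ?thesis
    using gx by (simp add: regular_subdiff_def)
qed

lemma regular_subset_limiting_subdiff: "regular_subdiff g x \<subseteq> limiting_subdiff g x"
proof
  fix \<zeta>
  assume "\<zeta> \<in> regular_subdiff g x"
  then show "\<zeta> \<in> limiting_subdiff g x"
    unfolding limiting_subdiff_def
    by (intro CollectI conjI exI[of _ "\<lambda>_. x"] exI[of _ "\<lambda>_. \<zeta>"])
      (simp_all add: regular_subdiff_def)
qed

section \<open>Concave penalties\<close>

lemma C1_differentiable_on_has_deriv:
  fixes \<phi> :: "real \<Rightarrow> real"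
  assumes "\<phi> C1_differentiable_on S" "t \<in> S"
  shows "(\<phi> has_real_derivative deriv \<phi> t) (at t)"
proof -
  obtain D where "(\<phi> has_real_derivative D t) (at t)"
    using assms by (auto simp: C1_differentiable_on_def has_real_derivative_iff_has_vector_derivative)
  then show ?thesis
    using DERIV_imp_deriv by metis
qed

locale concave_penalty =
  fixes \<phi> :: "real \<Rightarrow> real" and l M :: real
  assumes nonneg: "\<And>t. 0 \<le> t \<Longrightarrow> 0 \<le> \<phi> t"
    and cont: "continuous_on {0..} \<phi>"
    and concave: "concave_on {0..} \<phi>"
    and zero: "\<phi> 0 = 0"
    and C1: "\<phi> C1_differentiable_on {0<..}"
    and lim_deriv: "(deriv \<phi> \<longlongrightarrow> l) (at_right 0)"
    and lipschitz: "M-lipschitz_on {0..} (right_deriv \<phi>)"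
begin

lemma has_deriv: "0 < t \<Longrightarrow> (\<phi> has_real_derivative deriv \<phi> t) (at t)"
  using C1_differentiable_on_has_deriv[OF C1] by simp

lemma tangent: "0 < t \<Longrightarrow> 0 \<le> u \<Longrightarrow> \<phi> u - \<phi> t \<le> deriv \<phi> t * (u - t)"
  by (rule concave_below_tangent[OF concave]) (auto intro: has_deriv)

text \<open>Concavity makes \<open>deriv \<phi>\<close> nonincreasing, so its limit at \<open>0\<close> is its supremum.\<close>

lemma deriv_le_limit:
  assumes t: "0 < t"
  shows "deriv \<phi> t \<le> l"
proof (rule tendsto_lowerbound[OF lim_deriv])
  have "deriv \<phi> t \<le> deriv \<phi> s" if s: "0 < s" "s < t" for s
  proof -
    have "deriv \<phi> t * (t - s) \<le> deriv \<phi> s * (t - s)"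
      using tangent[of s t] tangent[of t s] s t by (simp add: algebra_simps)
    then show ?thesis
      using s by simp
  qed
  then show "\<forall>\<^sub>F s in at_right 0. deriv \<phi> t \<le> deriv \<phi> s"
    using t unfolding eventually_at_right_field by blast
qed simp

text \<open>The tangent inequality at the boundary point \<open>0\<close>, as the limit of tangents at \<open>s > 0\<close>.\<close>

lemma le_limit_mult:
  assumes t: "0 < t"
  shows "\<phi> t \<le> l * t"
proof -
  have "(\<phi> \<longlongrightarrow> \<phi> 0) (at 0 within {0..})"
    using cont by (simp add: continuous_on_def)
  then have \<phi>0: "(\<phi> \<longlongrightarrow> 0) (at_right 0)"
    using zero by (auto intro: tendsto_within_subset)
  have "\<phi> t - 0 \<le> l * (t - 0)"
  proof (rule tendsto_le)
    show "((\<lambda>s. l * (t - s)) \<longlongrightarrow> l * (t - 0)) (at_right 0)"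
      by (intro tendsto_intros)
    show "((\<lambda>s. \<phi> t - \<phi> s) \<longlongrightarrow> \<phi> t - 0) (at_right 0)"
      by (intro tendsto_intros \<phi>0)
    have "\<phi> t - \<phi> s \<le> l * (t - s)" if "0 < s" "s < t" for s
      using tangent[of s t] mult_right_mono[OF deriv_le_limit[of s], of "t - s"] that
      by (metis diff_ge_0_iff_ge less_imp_le order_less_trans order_trans)
    then show "\<forall>\<^sub>F s in at_right 0. \<phi> t - \<phi> s \<le> l * (t - s)"
      using t unfolding eventually_at_right_field by blast
  qed simp
  then show ?thesis
    by simp
qed

lemma right_deriv_pos:
  assumes "0 < t"
  shows "right_deriv \<phi> t = deriv \<phi> t"
proof -
  have "((\<lambda>h. (\<phi> (t + h) - \<phi> t) / h) \<longlongrightarrow> deriv \<phi> t) (at_right 0)"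
    using has_deriv[OF assms] unfolding DERIV_def by (rule filterlim_mono) (simp_all add: at_le)
  then show ?thesis
    unfolding right_deriv_def by (intro tendsto_Lim) simp_all
qed

lemma right_deriv_0: "right_deriv \<phi> 0 = l"
proof -
  have "((\<lambda>h. \<phi> h / h) \<longlongrightarrow> l) (at_right 0)"
  proof (rule tendsto_sandwich[OF _ _ lim_deriv tendsto_const])
    show "\<forall>\<^sub>F h in at_right 0. deriv \<phi> h \<le> \<phi> h / h"
      using eventually_at_right_less[of 0]
    proof eventually_elim
      case (elim h)
      then show ?case
        using tangent[of h 0] zero by (simp add: field_simps)
    qed
    show "\<forall>\<^sub>F h in at_right 0. \<phi> h / h \<le> l"
      using eventually_at_right_less[of 0]
      by eventually_elim (simp add: le_limit_mult divide_le_eq)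
  qed
  then show ?thesis
    unfolding right_deriv_def by (intro tendsto_Lim) (simp_all add: zero)
qed

lemma supergradient:
  assumes "0 \<le> t" "0 \<le> u"
  shows "\<phi> u - \<phi> t \<le> right_deriv \<phi> t * (u - t)"
proof (cases "t = 0")
  case True
  then show ?thesis
    using le_limit_mult[of u] assms zero by (cases "u = 0") (auto simp: right_deriv_0)
next
  case False
  then show ?thesis
    using tangent[of t u] assms by (simp add: right_deriv_pos)
qed

lemma right_deriv_le_0: "0 \<le> t \<Longrightarrow> right_deriv \<phi> t \<le> right_deriv \<phi> 0"
  using deriv_le_limit[of t] by (cases "t = 0") (auto simp: right_deriv_0 right_deriv_pos)

text \<open>A negative slope at \<open>t\<close> would push the supergradient line, which lies above \<open>\<phi>\<close>, below zero
  at the point \<open>u\<close> chosen in the proof.\<close>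

lemma right_deriv_nonneg:
  assumes t: "0 \<le> t"
  shows "0 \<le> right_deriv \<phi> t"
proof (rule ccontr)
  assume "\<not> ?thesis"
  then have neg: "right_deriv \<phi> t < 0"
    by simp
  define u where "u = t + (\<phi> t + 1) / (- right_deriv \<phi> t)"
  have u: "0 \<le> u"
    unfolding u_def using t neg nonneg[OF t]
    by (intro add_nonneg_nonneg divide_nonneg_pos) simp_all
  have "right_deriv \<phi> t * (u - t) = - (\<phi> t + 1)"
    using neg by (simp add: u_def)
  then show False
    using supergradient[OF t u] nonneg[OF u] by simp
qed

text \<open>Concavity at \<open>u\<close> gives the linear lower bound with slope \<open>right_deriv \<phi> u\<close>; Lipschitz continuity
  of the slope exchanges it for the slope at \<open>t\<close> at a quadratic cost. So \<open>\<phi>\<close> behaves, up to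
  second order, like the weighted absolute value that replaces it in the algorithm.\<close>

lemma quadratic_lower_bound:
  assumes t: "0 \<le> t" and u: "0 \<le> u"
  shows "right_deriv \<phi> t * (u - t) - M * (u - t)\<^sup>2 \<le> \<phi> u - \<phi> t"
proof -
  have "(right_deriv \<phi> t - right_deriv \<phi> u) * (u - t)
      \<le> \<bar>right_deriv \<phi> t - right_deriv \<phi> u\<bar> * \<bar>u - t\<bar>"
    by (metis abs_ge_self abs_mult)
  also have "\<dots> \<le> M * \<bar>t - u\<bar> * \<bar>u - t\<bar>"
    using lipschitz_onD[OF lipschitz, of t u] t u by (auto simp: dist_real_def intro!: mult_right_mono)
  also have "\<dots> = M * (u - t)\<^sup>2"
    by (simp add: power2_eq_square abs_minus_commute[of t u] mult.assoc flip: abs_mult)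
  finally show ?thesis
    using supergradient[OF u t] by (simp add: algebra_simps)
qed

end

lemma convex_on_weighted_abs:
  fixes w :: "real ^ 'n"
  assumes w: "\<And>i. 0 \<le> w $ i" and C: "convex C"
  shows "convex_on C (\<lambda>u. \<Sum>i\<in>UNIV. w $ i * \<bar>u $ i\<bar>)"
proof (rule convex_onI[OF _ C])
  fix t :: real and u v :: "real ^ 'n"
  assume t: "0 < t" "t < 1"
  have "w $ i * \<bar>((1 - t) *\<^sub>R u + t *\<^sub>R v) $ i\<bar>
      \<le> (1 - t) * (w $ i * \<bar>u $ i\<bar>) + t * (w $ i * \<bar>v $ i\<bar>)" for i
  proof -
    have "\<bar>(1 - t) * u $ i + t * v $ i\<bar> \<le> (1 - t) * \<bar>u $ i\<bar> + t * \<bar>v $ i\<bar>"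
      using abs_triangle_ineq[of "(1 - t) * u $ i" "t * v $ i"] t by (simp add: abs_mult)
    from mult_left_mono[OF this w[of i]] show ?thesis
      by (simp add: algebra_simps)
  qed
  then show "(\<Sum>i\<in>UNIV. w $ i * \<bar>((1 - t) *\<^sub>R u + t *\<^sub>R v) $ i\<bar>)
      \<le> (1 - t) * (\<Sum>i\<in>UNIV. w $ i * \<bar>u $ i\<bar>) + t * (\<Sum>i\<in>UNIV. w $ i * \<bar>v $ i\<bar>)"
    by (simp only: sum_distrib_left sum_mono flip: sum.distrib)
qed

section \<open>Descent of the potential\<close>

lemma weighted_square_add_le:
  fixes p q \<gamma> :: real
  assumes "0 < \<gamma>" "\<gamma> < 1"
  shows "(p + q)\<^sup>2 \<le> p\<^sup>2 / \<gamma> + q\<^sup>2 / (1 - \<gamma>)"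
proof -
  have "p\<^sup>2 / \<gamma> + q\<^sup>2 / (1 - \<gamma>) - (p + q)\<^sup>2 = ((1 - \<gamma>) * p - \<gamma> * q)\<^sup>2 / (\<gamma> * (1 - \<gamma>))"
    using assms by (simp add: divide_simps) (simp add: power2_eq_square algebra_simps)
  also have "\<dots> \<ge> 0"
    using assms by simp
  finally show ?thesis
    by simp
qed

text \<open>The number \<open>\<epsilon>\<close> is the distance from zero of the supremum in the condition on the extrapolation
  parameters; \<open>gap1\<close> and \<open>gap2\<close> are the two entries of the maximum.\<close>

locale IRL1e3_iterates = concave_penalty \<phi> l M
  for \<phi> :: "real \<Rightarrow> real" and l M :: real +
  fixes f :: "real ^ 'n \<Rightarrow> real" and gf :: "real ^ 'n \<Rightarrow> real ^ 'n" and C :: "(real ^ 'n) set"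
    and L \<epsilon> \<gamma> :: real and \<theta> :: "nat \<Rightarrow> real" and s y z x :: "nat \<Rightarrow> real ^ 'n"
  assumes f_convex: "convex_on UNIV f" and grad: "\<And>v. GDERIV f v :> gf v"
    and L: "0 < L" and grad_lipschitz: "L-lipschitz_on UNIV gf"
    and C_closed: "closed C" and C_convex: "convex C"
    and \<theta>: "\<And>k. 0 < \<theta> k" "\<And>k. \<theta> k \<le> 1"
    and \<gamma>: "0 < \<gamma>" "\<gamma> < 1" and \<epsilon>: "0 < \<epsilon>"
    and gap1: "\<And>k. (\<theta> (Suc k))\<^sup>2 * (1 - \<theta> k)\<^sup>2 / \<gamma> \<le> (\<theta> k)\<^sup>2 - \<epsilon>"
    and gap2: "\<And>k. (\<theta> (Suc k))\<^sup>2 / (1 - \<gamma>) \<le> 1 - \<epsilon>"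
    and iterates: "IRL1e3 L gf C \<phi> \<theta> s y z x"
begin

definition objective :: "real ^ 'n \<Rightarrow> real" where
  "objective u = f u + Phi \<phi> \<bar>u\<bar>"

definition weighted_l1 :: "nat \<Rightarrow> real ^ 'n \<Rightarrow> real" where
  "weighted_l1 k u = (\<Sum>i\<in>UNIV. s (Suc k) $ i * \<bar>u $ i\<bar>)"

text \<open>The point of the segment between \<open>x k\<close> and \<open>z (Suc k)\<close> that corresponds to \<open>y k\<close> after the
  \<open>z\<close>-update. It links the two proximal steps and is the third argument at which \<^const>\<open>H3\<close> is evaluated.\<close>

definition w :: "nat \<Rightarrow> real ^ 'n" where
  "w k = (1 - \<theta> k) *\<^sub>R x k + \<theta> k *\<^sub>R z (Suc k)"

definition potential :: "nat \<Rightarrow> real" where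
  "potential k = objective (x (Suc k)) + L / 2 * (norm (w k - x k))\<^sup>2
    + L / 2 * (norm (w k - x (Suc k)))\<^sup>2"

text \<open>The measure of progress: it bounds the step \<open>x (Suc k) - x k\<close>, the potential decreases by a
  multiple of its square, and two consecutive gaps bound the subgradients.\<close>

definition gap :: "nat \<Rightarrow> real" where
  "gap k = norm (z (Suc k) - x k) + norm (x (Suc k) - w k)"

lemma gap_nonneg: "0 \<le> gap k"
  by (simp add: gap_def)

lemma weight: "s (Suc k) $ i = right_deriv \<phi> \<bar>x k $ i\<bar>"
  using iterates by (simp add: IRL1e3_def)

lemma y_eq: "y k = (1 - \<theta> k) *\<^sub>R x k + \<theta> k *\<^sub>R z k"
  using iterates by (simp add: IRL1e3_def)

lemma z_min:
  "is_arg_min (\<lambda>u. gf (y k) \<bullet> (u - y k) + L * \<theta> k / 2 * (norm (u - z k))\<^sup>2 + weighted_l1 k u)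
    (\<lambda>u. u \<in> C) (z (Suc k))"
  using iterates unfolding IRL1e3_def weighted_l1_def by blast

lemma x_min:
  "is_arg_min (\<lambda>u. gf (y k) \<bullet> (u - y k) + L / 2 * (norm (u - y k))\<^sup>2 + weighted_l1 k u)
    (\<lambda>u. u \<in> C) (x (Suc k))"
  using iterates unfolding IRL1e3_def weighted_l1_def by blast

lemma x_in_C: "x k \<in> C"
  using iterates x_min by (cases k) (auto simp: IRL1e3_def is_arg_min_def)

lemma z_in_C: "z k \<in> C"
  using iterates z_min by (cases k) (auto simp: IRL1e3_def is_arg_min_def)

lemma w_in_C: "w k \<in> C"
  unfolding w_def using convexD_alt[OF C_convex x_in_C z_in_C] \<theta>[of k] by (simp add: less_imp_le)

lemma w_minus_x: "w k - x k = \<theta> k *\<^sub>R (z (Suc k) - x k)"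
  by (simp add: w_def scaleR_diff_right scaleR_diff_left)

lemma w_minus_y: "w k - y k = \<theta> k *\<^sub>R (z (Suc k) - z k)"
  by (simp add: w_def y_eq scaleR_diff_right)

lemma w_minus_z: "w k - z (Suc k) = (1 - \<theta> k) *\<^sub>R (x k - z (Suc k))"
  by (simp add: w_def scaleR_diff_right scaleR_diff_left)

lemma weighted_l1_convex: "convex_on C (weighted_l1 k)"
  unfolding weighted_l1_def[abs_def]
  by (rule convex_on_weighted_abs[OF _ C_convex]) (simp add: weight right_deriv_nonneg)

text \<open>The weights are supergradients of the penalty at \<open>x k\<close>, which is what makes reweighting a
  majorization method.\<close>

lemma Phi_majorized: "Phi \<phi> \<bar>u\<bar> - Phi \<phi> \<bar>x k\<bar> \<le> weighted_l1 k u - weighted_l1 k (x k)"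
  unfolding Phi_def weighted_l1_def sum_subtractf[symmetric] weight
  by (rule sum_mono) (use supergradient in \<open>auto simp: abs_vec_def right_diff_distrib\<close>)

text \<open>The accelerated three-point estimate: the \<open>x\<close>-step is compared with \<open>w k\<close> and the \<open>z\<close>-step with
  \<open>x k\<close>. Since \<open>w k - y k = \<theta> k *\<^sub>R (z (Suc k) - z k)\<close>, the second estimate, scaled by \<open>\<theta> k\<close>,
  cancels exactly the quadratic term at \<open>w k\<close> in the first one.\<close>

lemma accelerated_descent:
  "potential k \<le> objective (x k) + L / 2 * (\<theta> k)\<^sup>2 * (norm (x k - z k))\<^sup>2"
proof -
  let ?g = "gf (y k)" and ?P = "weighted_l1 k" and ?\<theta> = "\<theta> k"
  let ?x = "x k" and ?x' = "x (Suc k)" and ?z = "z k" and ?z' = "z (Suc k)" and ?y = "y k"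
  have upper: "f ?x' \<le> f ?y + ?g \<bullet> (?x' - ?y) + L / 2 * (norm (?x' - ?y))\<^sup>2"
    by (rule lipschitz_gradient_upper_bound[OF grad grad_lipschitz])
  have lower: "f ?y + ?g \<bullet> (?x - ?y) \<le> f ?x"
    by (rule convex_gradient_inequality[OF grad f_convex])
  have x3: "?g \<bullet> ?x' + L / 2 * (norm (?x' - ?y))\<^sup>2 + ?P ?x' + L / 2 * (norm (w k - ?x'))\<^sup>2
      \<le> ?g \<bullet> w k + L / 2 * (norm (w k - ?y))\<^sup>2 + ?P (w k)"
    by (rule prox_three_point[OF weighted_l1_convex x_min w_in_C])
  have z3: "?g \<bullet> ?z' + L * ?\<theta> / 2 * (norm (?z' - ?z))\<^sup>2 + ?P ?z' + L * ?\<theta> / 2 * (norm (?x - ?z'))\<^sup>2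
      \<le> ?g \<bullet> ?x + L * ?\<theta> / 2 * (norm (?x - ?z))\<^sup>2 + ?P ?x"
    by (rule prox_three_point[OF weighted_l1_convex z_min x_in_C])
  have scale: "\<theta>' * a + L / 2 * (\<theta>'\<^sup>2 * b) + \<theta>' * c + L / 2 * (\<theta>'\<^sup>2 * d)
      \<le> \<theta>' * a' + L / 2 * \<theta>'\<^sup>2 * b' + \<theta>' * c'"
    if "a + L * \<theta>' / 2 * b + c + L * \<theta>' / 2 * d \<le> a' + L * \<theta>' / 2 * b' + c'" "0 \<le> \<theta>'"
    for \<theta>' a b c d a' b' c' :: real
    using mult_left_mono[OF that] by (simp add: algebra_simps power2_eq_square)
  have z3': "?\<theta> * (?g \<bullet> ?z') + L / 2 * (?\<theta>\<^sup>2 * (norm (?z' - ?z))\<^sup>2) + ?\<theta> * ?P ?z'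
        + L / 2 * (?\<theta>\<^sup>2 * (norm (?x - ?z'))\<^sup>2)
      \<le> ?\<theta> * (?g \<bullet> ?x) + L / 2 * ?\<theta>\<^sup>2 * (norm (?x - ?z))\<^sup>2 + ?\<theta> * ?P ?x"
    using scale[OF z3] \<theta>(1)[of k] by (simp add: less_imp_le)
  have wy: "(norm (w k - ?y))\<^sup>2 = ?\<theta>\<^sup>2 * (norm (?z' - ?z))\<^sup>2"
    by (simp add: w_minus_y power_mult_distrib)
  have wx: "(norm (w k - ?x))\<^sup>2 = ?\<theta>\<^sup>2 * (norm (?x - ?z'))\<^sup>2"
    by (simp add: w_minus_x power_mult_distrib norm_minus_commute)
  have gw: "?g \<bullet> w k = ?g \<bullet> ?x - ?\<theta> * (?g \<bullet> ?x) + ?\<theta> * (?g \<bullet> ?z')"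
    by (simp add: w_def inner_add_right left_diff_distrib)
  have "?P (w k) \<le> (1 - ?\<theta>) * ?P ?x + ?\<theta> * ?P ?z'"
    unfolding w_def using \<theta>[of k]
    by (intro convex_onD[OF weighted_l1_convex] x_in_C z_in_C) (simp_all add: less_imp_le)
  then have Pw: "?P (w k) \<le> ?P ?x - ?\<theta> * ?P ?x + ?\<theta> * ?P ?z'"
    by (simp add: left_diff_distrib)
  have inner: "?g \<bullet> (?x' - ?y) = ?g \<bullet> ?x' - ?g \<bullet> ?y" "?g \<bullet> (?x - ?y) = ?g \<bullet> ?x - ?g \<bullet> ?y"
    by (simp_all add: inner_diff_right)
  show ?thesis
    using upper lower x3 z3' gw Pw Phi_majorized[of ?x' k]
    unfolding potential_def objective_def inner wy wx by linarith
qed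

text \<open>The parameter \<open>\<gamma>\<close> is the weight in the splitting of \<open>x (Suc k) - z (Suc k)\<close> into
  \<open>x (Suc k) - w k\<close> and \<open>w k - z (Suc k)\<close>; the two parts then meet the two entries of the
  parameter condition.\<close>

lemma extrapolation_bound:
  "(\<theta> (Suc k))\<^sup>2 * (norm (x (Suc k) - z (Suc k)))\<^sup>2
    \<le> ((\<theta> k)\<^sup>2 - \<epsilon>) * (norm (z (Suc k) - x k))\<^sup>2 + (1 - \<epsilon>) * (norm (x (Suc k) - w k))\<^sup>2"
proof -
  let ?a = "norm (z (Suc k) - x k)" and ?b = "norm (x (Suc k) - w k)"
  have "norm (w k - z (Suc k)) = (1 - \<theta> k) * ?a"
    using \<theta>(2)[of k] by (simp add: w_minus_z norm_minus_commute)
  then have "norm (x (Suc k) - z (Suc k)) \<le> (1 - \<theta> k) * ?a + ?b"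
    using norm_triangle_ineq[of "x (Suc k) - w k" "w k - z (Suc k)"] by simp
  then have "(norm (x (Suc k) - z (Suc k)))\<^sup>2 \<le> ((1 - \<theta> k) * ?a + ?b)\<^sup>2"
    by (rule power_mono) simp
  also have "\<dots> \<le> ((1 - \<theta> k) * ?a)\<^sup>2 / \<gamma> + ?b\<^sup>2 / (1 - \<gamma>)"
    by (rule weighted_square_add_le[OF \<gamma>])
  finally have "(\<theta> (Suc k))\<^sup>2 * (norm (x (Suc k) - z (Suc k)))\<^sup>2
      \<le> (\<theta> (Suc k))\<^sup>2 * (((1 - \<theta> k) * ?a)\<^sup>2 / \<gamma> + ?b\<^sup>2 / (1 - \<gamma>))"
    by (rule mult_left_mono) simp
  also have "\<dots> = ((\<theta> (Suc k))\<^sup>2 * (1 - \<theta> k)\<^sup>2 / \<gamma>) * ?a\<^sup>2 + ((\<theta> (Suc k))\<^sup>2 / (1 - \<gamma>)) * ?b\<^sup>2"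
    by (simp add: power_mult_distrib distrib_left)
  also have "\<dots> \<le> ((\<theta> k)\<^sup>2 - \<epsilon>) * ?a\<^sup>2 + (1 - \<epsilon>) * ?b\<^sup>2"
    by (intro add_mono mult_right_mono gap1 gap2) simp_all
  finally show ?thesis .
qed

lemma potential_descent: "potential (Suc k) + L * \<epsilon> / 4 * (gap k)\<^sup>2 \<le> potential k"
proof -
  let ?a = "norm (z (Suc k) - x k)" and ?b = "norm (x (Suc k) - w k)"
  have "(norm (w k - x k))\<^sup>2 = (\<theta> k)\<^sup>2 * ?a\<^sup>2"
    by (simp add: w_minus_x power_mult_distrib)
  then have V: "potential k = objective (x (Suc k)) + L / 2 * ((\<theta> k)\<^sup>2 * ?a\<^sup>2) + L / 2 * ?b\<^sup>2"
    by (simp add: potential_def norm_minus_commute)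
  have "potential (Suc k) \<le> objective (x (Suc k))
      + L / 2 * ((\<theta> (Suc k))\<^sup>2 * (norm (x (Suc k) - z (Suc k)))\<^sup>2)"
    using accelerated_descent[of "Suc k"] by (simp add: mult.assoc)
  also have "\<dots> \<le> objective (x (Suc k)) + L / 2 * (((\<theta> k)\<^sup>2 - \<epsilon>) * ?a\<^sup>2 + (1 - \<epsilon>) * ?b\<^sup>2)"
    using L extrapolation_bound[of k] by (intro add_left_mono mult_left_mono) simp_all
  also have "\<dots> = potential k - L * \<epsilon> / 2 * (?a\<^sup>2 + ?b\<^sup>2)"
    unfolding V by (simp add: algebra_simps)
  finally have "potential (Suc k) \<le> potential k - L * \<epsilon> / 2 * (?a\<^sup>2 + ?b\<^sup>2)" .
  moreover
  have "(gap k)\<^sup>2 \<le> 2 * (?a\<^sup>2 + ?b\<^sup>2)"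
    using sum_squares_bound[of ?a ?b] by (simp add: gap_def power2_sum)
  then have "L * \<epsilon> / 4 * (gap k)\<^sup>2 \<le> L * \<epsilon> / 4 * (2 * (?a\<^sup>2 + ?b\<^sup>2))"
    using L \<epsilon> by (intro mult_left_mono) simp_all
  moreover have "L * \<epsilon> / 4 * (2 * (?a\<^sup>2 + ?b\<^sup>2)) = L * \<epsilon> / 2 * (?a\<^sup>2 + ?b\<^sup>2)"
    by (simp only: times_divide_eq_left mult.assoc[symmetric])
  ultimately show ?thesis
    by linarith
qed

lemma w_step: "norm (w k - x k) \<le> norm (z (Suc k) - x k)"
  using \<theta>[of k] by (simp add: w_minus_x mult_left_le_one_le)

lemma x_step: "norm (x (Suc k) - x k) \<le> gap k"
  using norm_triangle_ineq[of "x (Suc k) - w k" "w k - x k"] w_step[of k] by (simp add: gap_def)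

section \<open>Vanishing subgradients\<close>

text \<open>An explicit subgradient of the objective at \<open>x (Suc k)\<close>. Its last term corrects the old weights
  \<open>s (Suc k)\<close>, for which the \<open>x\<close>-step is optimal, to the slopes of the penalty at \<open>x (Suc k)\<close>.\<close>

definition residual :: "nat \<Rightarrow> real ^ 'n" where
  "residual k = gf (x (Suc k)) - gf (y k) - L *\<^sub>R (x (Suc k) - y k)
    + (\<chi> i. (s (Suc (Suc k)) $ i - s (Suc k) $ i) * sgn (x (Suc k) $ i))"

lemma sgn_linearization:
  fixes t :: real
  assumes "t = 0 \<Longrightarrow> 0 \<le> c"
  shows "\<forall>\<^sub>F u in nhds t. c * sgn t * (u - t) \<le> c * (\<bar>u\<bar> - \<bar>t\<bar>)"
proof (cases t "0 :: real" rule: linorder_cases)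
  case equal
  then show ?thesis
    using assms by simp
next
  case less
  then have "\<forall>\<^sub>F u in nhds t. u < 0"
    by (intro order_tendstoD(2)[OF filterlim_ident])
  then show ?thesis
    by eventually_elim (use less in \<open>simp add: algebra_simps\<close>)
next
  case greater
  then have "\<forall>\<^sub>F u in nhds t. 0 < u"
    by (intro order_tendstoD(1)[OF filterlim_ident])
  then show ?thesis
    by eventually_elim (use greater in \<open>simp add: algebra_simps\<close>)
qed

text \<open>The optimality of the \<open>x\<close>-step controls the old weights, \<open>quadratic_lower_bound\<close> the new ones.
  It remains to linearize the difference \<open>(s (Suc (Suc k)) $ i - s (Suc k) $ i) * \<bar>u $ i\<bar>\<close>. Near a
  nonzero coordinate of \<open>x (Suc k)\<close> the absolute value is linear. At a zero coordinate it has
  a kink, but there the new weight is \<open>right_deriv \<phi> 0\<close>, the largest possible slope, so the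
  difference is nonnegative and the slope \<open>0\<close> bounds it from below.\<close>

lemma residual_subgradient:
  "\<forall>\<^sub>F u in nhds (x (Suc k)). u \<in> C \<longrightarrow>
    objective (x (Suc k)) + residual k \<bullet> (u - x (Suc k)) - M * (norm (u - x (Suc k)))\<^sup>2 \<le> objective u"
proof -
  let ?x = "x (Suc k)"
  let ?d = "\<lambda>i. s (Suc (Suc k)) $ i - s (Suc k) $ i"
  have "\<forall>\<^sub>F u in nhds ?x. \<forall>i. ?d i * sgn (?x $ i) * (u $ i - ?x $ i) \<le> ?d i * (\<bar>u $ i\<bar> - \<bar>?x $ i\<bar>)"
  proof (rule eventually_all_finite)
    fix i
    have "0 \<le> ?d i" if "?x $ i = 0"
      using right_deriv_le_0[of "\<bar>x k $ i\<bar>"] that by (simp add: weight)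
    then show "\<forall>\<^sub>F u in nhds ?x. ?d i * sgn (?x $ i) * (u $ i - ?x $ i) \<le> ?d i * (\<bar>u $ i\<bar> - \<bar>?x $ i\<bar>)"
      by (rule eventually_compose_filterlim[OF sgn_linearization])
        (assumption, rule tendsto_vec_nth[OF filterlim_ident])
  qed
  then show ?thesis
  proof eventually_elim
    case (elim u)
    show ?case
    proof
      assume u: "u \<in> C"
      have vi: "0 \<le> (gf (y k) + L *\<^sub>R (?x - y k)) \<bullet> (u - ?x) + weighted_l1 k u - weighted_l1 k ?x"
        by (rule prox_variational_inequality[OF weighted_l1_convex x_min u])
      have norm_square: "(norm (u - ?x))\<^sup>2 = (\<Sum>i\<in>UNIV. (u $ i - ?x $ i)\<^sup>2)"
        by (simp add: power2_norm_eq_inner inner_vec_def flip: power2_eq_square)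
      have "(\<chi> i. ?d i * sgn (?x $ i)) \<bullet> (u - ?x) \<le> (\<Sum>i\<in>UNIV. ?d i * (\<bar>u $ i\<bar> - \<bar>?x $ i\<bar>))"
        unfolding inner_vec_def by (rule sum_mono) (use elim in simp)
      also have "\<dots> = (\<Sum>i\<in>UNIV. s (Suc (Suc k)) $ i * (\<bar>u $ i\<bar> - \<bar>?x $ i\<bar>))
          - (weighted_l1 k u - weighted_l1 k ?x)"
        unfolding weighted_l1_def sum_subtractf[symmetric]
        by (rule sum.cong) (simp_all add: algebra_simps)
      also have "(\<Sum>i\<in>UNIV. s (Suc (Suc k)) $ i * (\<bar>u $ i\<bar> - \<bar>?x $ i\<bar>))
          \<le> (\<Sum>i\<in>UNIV. (\<phi> \<bar>u $ i\<bar> - \<phi> \<bar>?x $ i\<bar>) + M * (u $ i - ?x $ i)\<^sup>2)"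
      proof (rule sum_mono)
        fix i
        have "\<bar>\<bar>u $ i\<bar> - \<bar>?x $ i\<bar>\<bar> \<le> \<bar>u $ i - ?x $ i\<bar>"
          by (rule abs_triangle_ineq3)
        then have "M * (\<bar>u $ i\<bar> - \<bar>?x $ i\<bar>)\<^sup>2 \<le> M * (u $ i - ?x $ i)\<^sup>2"
          using lipschitz_on_nonneg[OF lipschitz] by (intro mult_left_mono) (simp_all add: abs_le_square_iff)
        then show "s (Suc (Suc k)) $ i * (\<bar>u $ i\<bar> - \<bar>?x $ i\<bar>)
            \<le> (\<phi> \<bar>u $ i\<bar> - \<phi> \<bar>?x $ i\<bar>) + M * (u $ i - ?x $ i)\<^sup>2"
          using quadratic_lower_bound[of "\<bar>?x $ i\<bar>" "\<bar>u $ i\<bar>"] by (simp add: weight)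
      qed
      also have "\<dots> = Phi \<phi> \<bar>u\<bar> - Phi \<phi> \<bar>?x\<bar> + M * (norm (u - ?x))\<^sup>2"
        unfolding norm_square by (simp add: sum.distrib sum_subtractf Phi_def abs_vec_def sum_distrib_left)
      finally have "(\<chi> i. ?d i * sgn (?x $ i)) \<bullet> (u - ?x) \<le> Phi \<phi> \<bar>u\<bar> - Phi \<phi> \<bar>?x\<bar>
          + M * (norm (u - ?x))\<^sup>2 - (weighted_l1 k u - weighted_l1 k ?x)"
        by simp
      moreover have "f ?x + gf ?x \<bullet> (u - ?x) \<le> f u"
        by (rule convex_gradient_inequality[OF grad f_convex])
      moreover have "residual k \<bullet> (u - ?x) = gf ?x \<bullet> (u - ?x)
          - (gf (y k) + L *\<^sub>R (?x - y k)) \<bullet> (u - ?x) + (\<chi> i. ?d i * sgn (?x $ i)) \<bullet> (u - ?x)"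
        by (simp only: residual_def inner_add_left inner_diff_left)
      ultimately show "objective ?x + residual k \<bullet> (u - ?x) - M * (norm (u - ?x))\<^sup>2 \<le> objective u"
        using vi unfolding objective_def by linarith
    qed
  qed
qed

lemma residual_bound: "norm (residual (Suc k)) \<le> (4 * L + M) * (gap k + gap (Suc k))"
proof -
  let ?x = "x (Suc (Suc k))" and ?y = "y (Suc k)" and ?w = "w (Suc k)"
  let ?v = "\<chi> i. (s (Suc (Suc (Suc k))) $ i - s (Suc (Suc k)) $ i) * sgn (?x $ i)"
  have M: "0 \<le> M"
    by (rule lipschitz_on_nonneg[OF lipschitz])
  have "\<bar>?v $ i\<bar> \<le> \<bar>(M *\<^sub>R (?x - x (Suc k))) $ i\<bar>" for i
  proof -
    have "\<bar>?v $ i\<bar> \<le> \<bar>right_deriv \<phi> \<bar>?x $ i\<bar> - right_deriv \<phi> \<bar>x (Suc k) $ i\<bar>\<bar>"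
      by (simp add: weight abs_mult abs_sgn_eq)
    also have "\<dots> \<le> M * \<bar>\<bar>?x $ i\<bar> - \<bar>x (Suc k) $ i\<bar>\<bar>"
      using lipschitz_onD[OF lipschitz, of "\<bar>?x $ i\<bar>" "\<bar>x (Suc k) $ i\<bar>"] by (simp add: dist_real_def)
    also have "\<dots> \<le> M * \<bar>?x $ i - x (Suc k) $ i\<bar>"
      using M by (intro mult_left_mono abs_triangle_ineq3)
    finally show ?thesis
      using M by (simp add: abs_mult)
  qed
  then have "norm ?v \<le> norm (M *\<^sub>R (?x - x (Suc k)))"
    by (intro norm_le_componentwise_cart) simp
  also have "\<dots> \<le> M * gap (Suc k)"
    using M x_step[of "Suc k"] by (simp add: mult_left_mono)
  finally have v: "norm ?v \<le> M * gap (Suc k)" .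
  have "norm (?w - ?y) \<le> norm (z (Suc (Suc k)) - z (Suc k))"
    using \<theta>[of "Suc k"] by (simp add: w_minus_y mult_left_le_one_le)
  also have "\<dots> \<le> norm (z (Suc (Suc k)) - x (Suc k)) + norm (x (Suc k) - w k) + norm (w k - z (Suc k))"
    using norm_triangle_ineq[of "z (Suc (Suc k)) - x (Suc k)" "x (Suc k) - w k"]
      norm_triangle_ineq[of "z (Suc (Suc k)) - w k" "w k - z (Suc k)"] by simp
  also have "norm (w k - z (Suc k)) \<le> norm (z (Suc k) - x k)"
    using \<theta>[of k] by (simp add: w_minus_z norm_minus_commute[of "x k"] mult_left_le_one_le)
  finally have wy: "norm (?w - ?y) \<le> norm (z (Suc (Suc k)) - x (Suc k)) + gap k"
    by (simp add: gap_def)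
  have "norm (?x - ?y) \<le> norm (?x - ?w) + norm (?w - ?y)"
    using norm_triangle_ineq[of "?x - ?w" "?w - ?y"] by simp
  then have xy: "norm (?x - ?y) \<le> gap (Suc k) + gap k"
    using wy by (simp add: gap_def)
  have "norm (gf ?x - gf ?y - L *\<^sub>R (?x - ?y)) \<le> norm (gf ?x - gf ?y) + norm (L *\<^sub>R (?x - ?y))"
    by (rule norm_triangle_ineq4)
  also have "\<dots> \<le> L * norm (?x - ?y) + L * norm (?x - ?y)"
    using lipschitz_onD[OF grad_lipschitz, of ?x ?y] L by (simp add: dist_norm)
  also have "\<dots> \<le> 2 * L * (gap (Suc k) + gap k)"
    using mult_left_mono[OF xy, of "2 * L"] L by simp
  finally have "norm (residual (Suc k)) \<le> 2 * L * (gap (Suc k) + gap k) + M * gap (Suc k)"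
    using v norm_triangle_ineq[of "gf ?x - gf ?y - L *\<^sub>R (?x - ?y)" ?v] unfolding residual_def by linarith
  also have "\<dots> \<le> (4 * L + M) * (gap k + gap (Suc k))"
    using L M gap_nonneg[of k] gap_nonneg[of "Suc k"] by (simp add: algebra_simps)
  finally show ?thesis .
qed

lemma M_nonneg: "0 \<le> M"
  by (rule lipschitz_on_nonneg[OF lipschitz])

lemma F_obj_eq: "F_obj f C \<phi> u = (if u \<in> C then ereal (objective u) else \<infinity>)"
  by (simp add: F_obj_def indicator_fun_def objective_def)

lemma H3_eq: "H3 L f C \<phi> (u, v, t) = (if u \<in> C then
    ereal (objective u + L / 2 * (norm (t - v))\<^sup>2 + L / 2 * (norm (t - u))\<^sup>2) else \<infinity>)"
  by (simp add: H3_def indicator_fun_def objective_def)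

lemma residual_in_subdiff: "residual k \<in> regular_subdiff (F_obj f C \<phi>) (x (Suc k))"
proof (rule regular_subdiffI)
  show "F_obj f C \<phi> (x (Suc k)) = ereal (objective (x (Suc k)))"
    by (simp add: F_obj_eq x_in_C)
  show "\<forall>\<^sub>F u in at (x (Suc k)). ereal (objective (x (Suc k)) + residual k \<bullet> (u - x (Suc k))
      - M * (norm (u - x (Suc k)))\<^sup>2) \<le> F_obj f C \<phi> u"
    using filter_leD[OF at_within_le_nhds residual_subgradient[of k]]
    by eventually_elim (simp add: F_obj_eq)
qed

text \<open>The points at which the KL inequality of \<^const>\<open>H3\<close> is used: \<open>potential k\<close> is the value of \<^const>\<open>H3\<close> there.\<close>

definition triple :: "nat \<Rightarrow> (real ^ 'n) \<times> (real ^ 'n) \<times> (real ^ 'n)" where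
  "triple k = (x (Suc k), x k, w k)"

definition residual3 :: "nat \<Rightarrow> (real ^ 'n) \<times> (real ^ 'n) \<times> (real ^ 'n)" where
  "residual3 k = (residual k + L *\<^sub>R (x (Suc k) - w k), L *\<^sub>R (x k - w k),
    L *\<^sub>R (w k - x k) + L *\<^sub>R (w k - x (Suc k)))"

lemma H3_triple: "H3 L f C \<phi> (triple k) = ereal (potential k)"
  by (simp add: triple_def H3_eq potential_def x_in_C)

text \<open>The two squared distances are convex, so their gradients simply add to \<open>residual k\<close>.\<close>

lemma residual3_in_subdiff: "residual3 k \<in> regular_subdiff (H3 L f C \<phi>) (triple k)"
proof (rule regular_subdiffI)
  show "H3 L f C \<phi> (triple k) = ereal (potential k)"
    by (rule H3_triple)
next
  let ?x = "x (Suc k)" and ?y = "x k" and ?w = "w k"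
  have "(fst \<longlongrightarrow> ?x) (at (triple k))"
    using tendsto_fst[OF tendsto_ident_at, of "triple k" UNIV] by (simp add: triple_def)
  from eventually_compose_filterlim[OF residual_subgradient this]
  show "\<forall>\<^sub>F v in at (triple k). ereal (potential k + residual3 k \<bullet> (v - triple k)
      - M * (norm (v - triple k))\<^sup>2) \<le> H3 L f C \<phi> v"
  proof eventually_elim
    case (elim v)
    obtain u q t where v: "v = (u, q, t)"
      by (cases v) auto
    show ?case
    proof (cases "u \<in> C")
      case True
      have quad: "L / 2 * (norm a)\<^sup>2 + L * (a \<bullet> (b - a)) \<le> L / 2 * (norm b)\<^sup>2" for a b :: "real ^ 'n"
      proof -
        have "(norm a)\<^sup>2 + 2 * (a \<bullet> (b - a)) \<le> (norm b)\<^sup>2"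
          using norm_add_square[of a "b - a"] by simp
        from mult_left_mono[OF this, of "L / 2"] L show ?thesis
          by (simp add: distrib_left)
      qed
      have "norm (u - ?x) \<le> norm (v - triple k)"
        by (simp add: v triple_def norm_fst_le)
      then have "M * (norm (u - ?x))\<^sup>2 \<le> M * (norm (v - triple k))\<^sup>2"
        using M_nonneg by (intro mult_left_mono power_mono) simp_all
      moreover have "objective ?x + residual k \<bullet> (u - ?x) - M * (norm (u - ?x))\<^sup>2 \<le> objective u"
        using elim True by (simp add: v)
      moreover have "residual3 k \<bullet> (v - triple k) = residual k \<bullet> (u - ?x)
          + L * ((?w - ?y) \<bullet> ((t - q) - (?w - ?y))) + L * ((?w - ?x) \<bullet> ((t - u) - (?w - ?x)))"
        by (simp add: v triple_def residual3_def inner_add_left inner_diff_left inner_diff_right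
            right_diff_distrib distrib_left)
      ultimately have "potential k + residual3 k \<bullet> (v - triple k) - M * (norm (v - triple k))\<^sup>2
          \<le> objective u + L / 2 * (norm (t - q))\<^sup>2 + L / 2 * (norm (t - u))\<^sup>2"
        using quad[of "?w - ?y" "t - q"] quad[of "?w - ?x" "t - u"]
        unfolding potential_def by linarith
      then show ?thesis
        using True by (simp add: v H3_eq)
    qed (simp add: v H3_eq)
  qed
qed

lemma residual3_bound: "norm (residual3 (Suc k)) \<le> (6 * L + M) * (gap k + gap (Suc k))"
proof -
  let ?x = "x (Suc (Suc k))" and ?y = "x (Suc k)" and ?w = "w (Suc k)"
  have "norm (residual3 (Suc k)) \<le> norm (residual (Suc k) + L *\<^sub>R (?x - ?w))
      + (norm (L *\<^sub>R (?y - ?w)) + norm (L *\<^sub>R (?w - ?y) + L *\<^sub>R (?w - ?x)))"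
    unfolding residual3_def by (intro order_trans[OF norm_Pair_le] add_left_mono norm_Pair_le)
  also have "\<dots> \<le> norm (residual (Suc k)) + 2 * (norm (L *\<^sub>R (?x - ?w)) + norm (L *\<^sub>R (?w - ?y)))"
    using norm_triangle_ineq[of "residual (Suc k)" "L *\<^sub>R (?x - ?w)"]
      norm_triangle_ineq[of "L *\<^sub>R (?w - ?y)" "L *\<^sub>R (?w - ?x)"] L
    by (simp add: norm_minus_commute)
  also have "norm (L *\<^sub>R (?x - ?w)) + norm (L *\<^sub>R (?w - ?y)) \<le> L * gap (Suc k)"
    using mult_left_mono[OF w_step[of "Suc k"], of L] L by (simp add: gap_def distrib_left)
  also have "norm (residual (Suc k)) \<le> (4 * L + M) * (gap k + gap (Suc k))"
    by (rule residual_bound)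
  also have "(4 * L + M) * (gap k + gap (Suc k)) + 2 * (L * gap (Suc k))
      \<le> (6 * L + M) * (gap k + gap (Suc k))"
    using L gap_nonneg[of k] by (simp add: algebra_simps)
  finally show ?thesis
    by simp
qed

section \<open>Convergence\<close>

lemma objective_continuous: "continuous_on UNIV objective"
proof -
  have "continuous_on UNIV f"
    using grad unfolding gderiv_def
    by (intro continuous_at_imp_continuous_on) (auto intro: has_derivative_continuous)
  moreover have "continuous_on UNIV (\<lambda>u :: real ^ 'n. \<phi> \<bar>u $ i\<bar>)" for i
    by (rule continuous_on_compose2[OF cont]) (auto intro!: continuous_intros)
  ultimately show ?thesis
    unfolding objective_def[abs_def] Phi_def abs_vec_def
    by (simp add: continuous_on_add continuous_on_sum)
qed

lemma objective_tendsto: "(u \<longlongrightarrow> p) F \<Longrightarrow> ((\<lambda>k. objective (u k)) \<longlongrightarrow> objective p) F"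
  using objective_continuous by (rule continuous_on_tendsto_compose) simp_all

lemma potential_decseq: "decseq potential"
proof (rule decseq_SucI)
  fix k
  have "0 \<le> L * \<epsilon> / 4 * (gap k)\<^sup>2"
    using L \<epsilon> by simp
  then show "potential (Suc k) \<le> potential k"
    using potential_descent[of k] by linarith
qed

lemma objective_le_potential: "objective (x (Suc k)) \<le> potential k"
  using L by (simp add: potential_def)

lemma x_bounded:
  assumes "\<And>\<alpha>::real. bounded {v. F_obj f C \<phi> v \<le> ereal \<alpha>}"
  shows "bounded (range (\<lambda>k. x (Suc k)))"
proof (rule bounded_subset[OF assms])
  show "range (\<lambda>k. x (Suc k)) \<subseteq> {v. F_obj f C \<phi> v \<le> ereal (potential 0)}"
    using order_trans[OF objective_le_potential decseqD[OF potential_decseq]]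
    by (auto simp: F_obj_eq x_in_C)
qed

lemma potential_bounded_below:
  assumes "bounded (range (\<lambda>k. x (Suc k)))"
  obtains B where "\<And>k. B \<le> potential k"
proof -
  obtain R where R: "\<And>k. norm (x (Suc k)) \<le> R"
    using assms by (auto simp: bounded_iff)
  have "f 0 - norm (gf 0) * R \<le> potential k" for k
  proof -
    have "- (gf 0 \<bullet> x (Suc k)) \<le> norm (gf 0) * norm (x (Suc k))"
      using norm_cauchy_schwarz[of "- gf 0" "x (Suc k)"] by simp
    also have "\<dots> \<le> norm (gf 0) * R"
      using R by (simp add: mult_left_mono)
    finally have "f 0 - norm (gf 0) * R \<le> f (x (Suc k))"
      using convex_gradient_inequality[OF grad f_convex, of 0 "x (Suc k)"] by simp
    also have "\<dots> \<le> objective (x (Suc k))"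
      unfolding objective_def Phi_def by (simp add: sum_nonneg nonneg abs_vec_def)
    finally show ?thesis
      using objective_le_potential[of k] by linarith
  qed
  then show thesis
    by (rule that)
qed

lemma gap_tendsto_0:
  assumes "potential \<longlonglongrightarrow> v"
  shows "gap \<longlonglongrightarrow> 0"
proof -
  let ?c = "L * \<epsilon> / 4"
  have c: "0 < ?c"
    using L \<epsilon> by simp
  have "(\<lambda>k. (potential k - potential (Suc k)) / ?c) \<longlonglongrightarrow> (v - v) / ?c"
    by (intro tendsto_intros assms LIMSEQ_Suc[OF assms]) (use L \<epsilon> in simp)
  then have lim: "(\<lambda>k. (potential k - potential (Suc k)) / ?c) \<longlonglongrightarrow> 0"
    by simp
  have "(\<lambda>k. (gap k)\<^sup>2) \<longlonglongrightarrow> 0"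
  proof (rule tendsto_sandwich[OF _ _ tendsto_const lim])
    have "(gap k)\<^sup>2 \<le> (potential k - potential (Suc k)) / ?c" for k
      using potential_descent[of k] c by (subst pos_le_divide_eq) (simp_all add: mult.commute)
    then show "\<forall>\<^sub>F k in sequentially. (gap k)\<^sup>2 \<le> (potential k - potential (Suc k)) / ?c"
      by simp
  qed simp
  then have "(\<lambda>k. sqrt ((gap k)\<^sup>2)) \<longlonglongrightarrow> sqrt 0"
    by (rule tendsto_real_sqrt)
  then show ?thesis
    by (simp add: gap_nonneg)
qed

lemma residuals_tendsto_0:
  assumes "gap \<longlonglongrightarrow> 0"
  shows "residual \<longlonglongrightarrow> 0" "residual3 \<longlonglongrightarrow> 0"
proof -
  have lim: "(\<lambda>k. c * (gap k + gap (Suc k))) \<longlonglongrightarrow> 0" for c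
    using assms LIMSEQ_Suc[OF assms] by (auto intro!: tendsto_eq_intros)
  have "(\<lambda>k. residual (Suc k)) \<longlonglongrightarrow> 0"
    by (rule Lim_null_comparison[OF _ lim[of "4 * L + M"]]) (simp add: residual_bound)
  then show "residual \<longlonglongrightarrow> 0"
    by (simp only: filterlim_sequentially_Suc)
  have "(\<lambda>k. residual3 (Suc k)) \<longlonglongrightarrow> 0"
    by (rule Lim_null_comparison[OF _ lim[of "6 * L + M"]]) (simp add: residual3_bound)
  then show "residual3 \<longlonglongrightarrow> 0"
    by (simp only: filterlim_sequentially_Suc)
qed

lemma triple_near: "dist (triple k) (p, p, p) \<le> 3 * dist (x (Suc k)) p + 2 * gap k"
proof -
  have "dist (triple k) (p, p, p) \<le> dist (x (Suc k)) p + (dist (x k) p + dist (w k) p)"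
    unfolding triple_def dist_norm diff_Pair
    by (intro order_trans[OF norm_Pair_le] add_left_mono norm_Pair_le)
  moreover have "dist (x k) p \<le> gap k + dist (x (Suc k)) p"
    using dist_triangle[of "x k" p "x (Suc k)"] x_step[of k] by (simp add: dist_norm norm_minus_commute)
  moreover have "dist (w k) p \<le> gap k + dist (x (Suc k)) p"
  proof -
    have "dist (w k) (x (Suc k)) \<le> gap k"
      by (simp add: gap_def dist_norm norm_minus_commute[of "w k"])
    then show ?thesis
      using dist_triangle[of "w k" p "x (Suc k)"] by linarith
  qed
  ultimately show ?thesis
    by simp
qed

text \<open>The KL inequality at the single cluster point \<open>(p, p, p)\<close> suffices, because once the gaps are
  small the whole triple is close to it as soon as \<open>x (Suc k)\<close> is close to \<open>p\<close>.\<close>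

lemma gap_summable:
  assumes KL: "KL_property_at (H3 L f C \<phi>) (p, p, p)"
    and lim: "potential \<longlonglongrightarrow> objective p" and p: "p \<in> C"
    and r: "strict_mono r" "((\<lambda>k. x (Suc k)) \<circ> r) \<longlonglongrightarrow> p"
  shows "summable gap"
proof -
  let ?h = "H3 L f C \<phi>"
  have hp: "?h (p, p, p) = ereal (objective p)"
    using p by (simp add: H3_eq)
  obtain a U \<psi> where a: "0 < a" and U: "open U" "(p, p, p) \<in> U" and \<psi>: "\<psi> \<in> Xi a"
    and desingularize: "\<And>v. v \<in> U \<Longrightarrow> ?h (p, p, p) < ?h v \<Longrightarrow> ?h v < ?h (p, p, p) + a \<Longrightarrow>
      1 \<le> ereal (deriv \<psi> (real_of_ereal (?h v - ?h (p, p, p)))) * edist_set 0 (limiting_subdiff ?h v)"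
    using KL unfolding KL_property_at_def by blast
  \<comment> \<open>The range of the KL inequality may be infinite; a finite subinterval is enough.\<close>
  obtain b where b: "0 < b" "ereal b < a"
    using ereal_dense2[OF a] by auto
  have sub: "{0..<b} \<subseteq> {t. 0 \<le> t \<and> ereal t < a}" "\<And>t. t < b \<Longrightarrow> ereal t < a"
    using b(2) by (auto intro: less_trans[of "ereal _" "ereal b"])
  obtain \<rho> where \<rho>: "0 < \<rho>" and ball: "ball (p, p, p) \<rho> \<subseteq> U"
    using U openE by blast
  have gap0: "gap \<longlonglongrightarrow> 0"
    by (rule gap_tendsto_0[OF lim])
  show ?thesis
  proof (rule KL_finite_length[where X = "\<lambda>k. x (Suc k)" and D = gap and V = potential
        and \<phi> = \<psi> and \<phi>' = "deriv \<psi>" and p = p and \<rho> = "\<rho> / 6" and a = b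
        and c = "L * \<epsilon> / 4" and b = "6 * L + M" and Vs = "objective p" and r = r])
    show "0 < L * \<epsilon> / 4" "0 \<le> 6 * L + M"
      using L \<epsilon> M_nonneg by simp_all
    show "concave_on {0..<b} \<psi>"
      using \<psi> sub(1) unfolding Xi_def concave_on_def by (auto intro: convex_on_subset)
    show "continuous_on {0..<b} \<psi>"
      using \<psi> sub(1) unfolding Xi_def by (auto intro: continuous_on_subset)
    show "0 \<le> \<psi> t" if "0 \<le> t" "t < b" for t
      using \<psi> sub(2)[OF that(2)] that by (auto simp: Xi_def)
    show "\<psi> 0 = 0"
      using \<psi> by (simp add: Xi_def)
    show "(\<psi> has_real_derivative deriv \<psi> t) (at t)" if "0 < t" "t < b" for t
      using \<psi> sub(2)[OF that(2)] that
      by (intro C1_differentiable_on_has_deriv[of \<psi> "{t. 0 < t \<and> ereal t < a}"]) (auto simp: Xi_def)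
    show "dist (x (Suc (Suc k))) (x (Suc k)) \<le> gap (Suc k)" for k
      using x_step[of "Suc k"] by (simp add: dist_norm)
    have "\<forall>\<^sub>F k in sequentially. gap (Suc k) < \<rho> / 4"
      using order_tendstoD(2)[OF LIMSEQ_Suc[OF gap0], of "\<rho> / 4"] \<rho> by simp
    then show "\<forall>\<^sub>F k in sequentially. dist (x (Suc (Suc k))) p < \<rho> / 6 \<longrightarrow>
        objective p < potential (Suc k) \<longrightarrow> potential (Suc k) < objective p + b \<longrightarrow>
        1 \<le> deriv \<psi> (potential (Suc k) - objective p) * ((6 * L + M) * (gap k + gap (Suc k)))"
    proof eventually_elim
      case (elim k)
      show ?case
      proof (intro impI)
        assume near: "dist (x (Suc (Suc k))) p < \<rho> / 6"
          and above: "objective p < potential (Suc k)" and below: "potential (Suc k) < objective p + b"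
        let ?v = "triple (Suc k)" and ?t = "potential (Suc k) - objective p"
        have v: "?h ?v = ereal (potential (Suc k))"
          by (rule H3_triple)
        have t: "0 < ?t" "ereal ?t < a"
          using above below by (auto intro: sub(2))
        have "dist ?v (p, p, p) < \<rho>"
          using triple_near[of "Suc k" p] near elim by linarith
        then have "?v \<in> U"
          using ball by (auto simp: dist_commute)
        moreover have "?h ?v < ?h (p, p, p) + a"
          using t(2) by (cases a) (auto simp: v hp)
        ultimately have "1 \<le> ereal (deriv \<psi> ?t) * edist_set 0 (limiting_subdiff ?h ?v)"
          using desingularize[of ?v] above by (simp add: v hp)
        also have "edist_set 0 (limiting_subdiff ?h ?v) \<le> ereal (norm (residual3 (Suc k)))"
          unfolding edist_set_def
          using residual3_in_subdiff[of "Suc k"] regular_subset_limiting_subdiff[of ?h ?v]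
          by (intro INF_lower2[of "residual3 (Suc k)"]) auto
        also have "norm (residual3 (Suc k)) \<le> (6 * L + M) * (gap k + gap (Suc k))"
          by (rule residual3_bound)
        finally show "1 \<le> deriv \<psi> ?t * ((6 * L + M) * (gap k + gap (Suc k)))"
          using \<psi> t by (auto simp: Xi_def one_ereal_def ereal_mult_left_mono mult_left_mono less_imp_le)
      qed
    qed
  qed (use gap0 gap_nonneg potential_descent lim r b \<rho> in \<open>auto simp: algebra_simps\<close>)
qed

text \<open>A cluster point \<open>p\<close> of the bounded sequence has the value to which the potential converges, and the
  triple \<open>(p, p, p)\<close> lies in the domain of the subdifferential because the residuals vanish. This
  makes the KL property available. Summability of the gaps then gives convergence, and the
  residuals, now read as subgradients of the objective alone, show that the limit is stationary.\<close>

lemma iterates_converge: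
  assumes level: "\<And>\<alpha>::real. bounded {v. F_obj f C \<phi> v \<le> ereal \<alpha>}"
    and KL: "KL_function (H3 L f C \<phi>)"
  shows "summable (\<lambda>k. norm (x (Suc k) - x k)) \<and>
    (\<exists>q. x \<longlonglongrightarrow> q \<and> 0 \<in> limiting_subdiff (F_obj f C \<phi>) q)"
proof -
  have bounded: "bounded (range (\<lambda>k. x (Suc k)))"
    by (rule x_bounded[OF level])
  obtain B where "\<And>k. B \<le> potential k"
    using potential_bounded_below[OF bounded] by blast
  then obtain v where v: "potential \<longlonglongrightarrow> v"
    using decseq_convergent[OF potential_decseq] by metis
  have gap0: "gap \<longlonglongrightarrow> 0"
    by (rule gap_tendsto_0[OF v])
  obtain p r where r: "strict_mono r" "((\<lambda>k. x (Suc k)) \<circ> r) \<longlonglongrightarrow> p"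
    using bounded_imp_convergent_subsequence[OF bounded] by blast
  have p: "p \<in> C"
    using closed_sequentially[OF C_closed _ r(2)] x_in_C by simp
  have xr: "(\<lambda>j. x (Suc (r j))) \<longlonglongrightarrow> p"
    using r(2) by (simp add: o_def)
  have gapr: "(\<lambda>j. gap (r j)) \<longlonglongrightarrow> 0"
    using LIMSEQ_subseq_LIMSEQ[OF gap0 r(1)] by (simp add: o_def)
  have "(\<lambda>j. 3 * dist (x (Suc (r j))) p + 2 * gap (r j)) \<longlonglongrightarrow> 3 * dist p p + 2 * 0"
    by (intro tendsto_intros xr gapr)
  then have "(\<lambda>j. 3 * dist (x (Suc (r j))) p + 2 * gap (r j)) \<longlonglongrightarrow> 0"
    by simp
  then have "(\<lambda>j. dist (triple (r j)) (p, p, p)) \<longlonglongrightarrow> 0"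
    by (rule Lim_null_comparison[rotated]) (simp add: triple_near)
  then have triple: "(\<lambda>j. triple (r j)) \<longlonglongrightarrow> (p, p, p)"
    by (rule iffD2[OF tendsto_dist_iff])
  have xk: "(\<lambda>j. x (r j)) \<longlonglongrightarrow> p" and wk: "(\<lambda>j. w (r j)) \<longlonglongrightarrow> p"
    using tendsto_fst[OF tendsto_snd[OF triple]] tendsto_snd[OF tendsto_snd[OF triple]]
    by (simp_all add: triple_def)
  have "(\<lambda>j. potential (r j)) \<longlonglongrightarrow>
      objective p + L / 2 * (norm (p - p))\<^sup>2 + L / 2 * (norm (p - p))\<^sup>2"
    unfolding potential_def by (intro tendsto_intros objective_tendsto xr xk wk)
  then have pot: "(\<lambda>j. potential (r j)) \<longlonglongrightarrow> objective p"
    by simp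
  moreover have "(\<lambda>j. potential (r j)) \<longlonglongrightarrow> v"
    using LIMSEQ_subseq_LIMSEQ[OF v r(1)] by (simp add: o_def)
  ultimately have v_eq: "v = objective p"
    using LIMSEQ_unique by blast
  have "0 \<in> limiting_subdiff (H3 L f C \<phi>) (p, p, p)"
    unfolding limiting_subdiff_def
  proof (intro CollectI conjI exI)
    show "(\<lambda>j. triple (r j)) \<longlonglongrightarrow> (p, p, p)"
      by (rule triple)
    show "(\<lambda>j. H3 L f C \<phi> (triple (r j))) \<longlonglongrightarrow> H3 L f C \<phi> (p, p, p)"
      using pot p by (simp add: H3_triple H3_eq)
    show "\<forall>j. residual3 (r j) \<in> regular_subdiff (H3 L f C \<phi>) (triple (r j))"
      by (simp add: residual3_in_subdiff)
    show "(\<lambda>j. residual3 (r j)) \<longlonglongrightarrow> 0"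
      using LIMSEQ_subseq_LIMSEQ[OF residuals_tendsto_0(2)[OF gap0] r(1)] by (simp add: o_def)
  qed (use p in \<open>simp add: H3_eq\<close>)
  then have "KL_property_at (H3 L f C \<phi>) (p, p, p)"
    using KL by (auto simp: KL_function_def dom_subdiff_def)
  then have "summable gap"
    using v unfolding v_eq by (rule gap_summable[OF _ _ p r])
  then have length: "summable (\<lambda>k. norm (x (Suc k) - x k))"
    by (rule summable_comparison_test'[where N = 0]) (simp add: x_step)
  then have "summable (\<lambda>k. x (Suc k) - x k)"
    by (rule summable_norm_cancel)
  then have "(\<lambda>n. \<Sum>k<n. x (Suc k) - x k) \<longlonglongrightarrow> (\<Sum>k. x (Suc k) - x k)"
    by (rule summable_LIMSEQ)
  then have "(\<lambda>n. x n - x 0 + x 0) \<longlonglongrightarrow> (\<Sum>k. x (Suc k) - x k) + x 0"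
    unfolding sum_lessThan_telescope by (intro tendsto_intros)
  then obtain q where q: "x \<longlonglongrightarrow> q"
    by simp
  have "q \<in> C"
    using closed_sequentially[OF C_closed _ q] x_in_C by simp
  have "0 \<in> limiting_subdiff (F_obj f C \<phi>) q"
    unfolding limiting_subdiff_def
  proof (intro CollectI conjI exI)
    show "(\<lambda>k. x (Suc k)) \<longlonglongrightarrow> q"
      by (rule LIMSEQ_Suc[OF q])
    show "(\<lambda>k. F_obj f C \<phi> (x (Suc k))) \<longlonglongrightarrow> F_obj f C \<phi> q"
      using objective_tendsto[OF LIMSEQ_Suc[OF q]] \<open>q \<in> C\<close> by (simp add: F_obj_eq x_in_C)
    show "\<forall>k. residual k \<in> regular_subdiff (F_obj f C \<phi>) (x (Suc k))"
      by (simp add: residual_in_subdiff)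
    show "residual \<longlonglongrightarrow> 0"
      by (rule residuals_tendsto_0(1)[OF gap0])
  qed (use \<open>q \<in> C\<close> in \<open>simp add: F_obj_eq\<close>)
  then show ?thesis
    using length q by blast
qed

end

text \<open>A supremum of reals is meaningful only for a set that is bounded above, hence the hypothesis on \<open>B\<close>.\<close>

lemma uniform_gap_of_SUP:
  fixes g :: "nat \<Rightarrow> real"
  assumes "(SUP k\<in>{1..}. g k) < 0" and "\<And>k. 1 \<le> k \<Longrightarrow> g k \<le> B"
  shows "\<exists>\<epsilon>>0. \<forall>k. g (Suc k) \<le> - \<epsilon>"
proof (intro exI conjI allI)
  have "bdd_above (g ` {1..})"
    using assms(2) by (auto simp: bdd_above_def)
  then show "g (Suc k) \<le> - (- Sup (g ` {1..}))" for k
    by (auto intro: cSUP_upper)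
qed (use assms(1) in simp)

theorem theorem5p4:
  fixes f :: "real ^ 'n \<Rightarrow> real"
    and gf :: "real ^ 'n \<Rightarrow> real ^ 'n"
    and C :: "(real ^ 'n) set"
    and \<phi> :: "real \<Rightarrow> real"
    and L l \<gamma> :: real
    and \<theta> :: "nat \<Rightarrow> real"
    and x y z s :: "nat \<Rightarrow> real ^ 'n"
  assumes "convex_on UNIV f"
    and "\<And>v. GDERIV f v :> gf v"
    and "continuous_on UNIV gf"
    and "0 < L"
    and "L-lipschitz_on UNIV gf"
    and "C \<noteq> {}" and "closed C" and "convex C"
    and "\<And>t. 0 \<le> t \<Longrightarrow> 0 \<le> \<phi> t"
    and "continuous_on {0..} \<phi>"
    and "concave_on {0..} \<phi>"
    and "\<phi> 0 = 0"
    and "\<phi> C1_differentiable_on {0<..}"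
    and "(deriv \<phi> \<longlongrightarrow> l) (at_right 0)"
    and "\<And>\<alpha>::real. bounded {v. F_obj f C \<phi> v \<le> ereal \<alpha>}"
    and "\<And>k. 0 < \<theta> k \<and> \<theta> k \<le> 1"
    and "0 < \<gamma>" and "\<gamma> < 1"
    and "(SUP k\<in>{1..}. max ((\<theta> k)\<^sup>2 * (1 - \<theta> (k - 1))\<^sup>2 / \<gamma> - (\<theta> (k - 1))\<^sup>2)
                            ((\<theta> k)\<^sup>2 / (1 - \<gamma>) - 1)) < 0"
    and "KL_function (H3 L f C \<phi>)"
    and "\<exists>M. M-lipschitz_on {0..} (right_deriv \<phi>)"
    and "IRL1e3 L gf C \<phi> \<theta> s y z x"
  shows "summable (\<lambda>k. norm (x (Suc k) - x k)) \<and>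
         (\<exists>xbar. x \<longlonglongrightarrow> xbar \<and> 0 \<in> limiting_subdiff (F_obj f C \<phi>) xbar)"
proof -
  obtain M where M: "M-lipschitz_on {0..} (right_deriv \<phi>)"
    using assms(21) by blast
  have \<theta>: "(\<theta> k)\<^sup>2 \<le> 1" "(1 - \<theta> k)\<^sup>2 \<le> 1" for k
    using assms(16)[of k] by (simp_all add: power_le_one)
  have "max ((\<theta> k)\<^sup>2 * (1 - \<theta> (k - 1))\<^sup>2 / \<gamma> - (\<theta> (k - 1))\<^sup>2) ((\<theta> k)\<^sup>2 / (1 - \<gamma>) - 1)
      \<le> 1 / \<gamma> + 1 / (1 - \<gamma>)" for k
  proof (rule max.boundedI)
    have "(\<theta> k)\<^sup>2 * (1 - \<theta> (k - 1))\<^sup>2 / \<gamma> \<le> 1 / \<gamma>"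
      using assms(17) \<theta> by (intro divide_right_mono mult_le_one) simp_all
    moreover have "0 \<le> 1 / (1 - \<gamma>)"
      using assms(18) by simp
    ultimately show "(\<theta> k)\<^sup>2 * (1 - \<theta> (k - 1))\<^sup>2 / \<gamma> - (\<theta> (k - 1))\<^sup>2 \<le> 1 / \<gamma> + 1 / (1 - \<gamma>)"
      using zero_le_power2[of "\<theta> (k - 1)"] by linarith
    have "(\<theta> k)\<^sup>2 / (1 - \<gamma>) \<le> 1 / (1 - \<gamma>)"
      using assms(18) \<theta> by (intro divide_right_mono) simp_all
    moreover have "0 \<le> 1 / \<gamma>"
      using assms(17) by simp
    ultimately show "(\<theta> k)\<^sup>2 / (1 - \<gamma>) - 1 \<le> 1 / \<gamma> + 1 / (1 - \<gamma>)"
      by linarith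
  qed
  then obtain \<epsilon> where \<epsilon>: "0 < \<epsilon>" and gap: "\<And>k. max ((\<theta> (Suc k))\<^sup>2 * (1 - \<theta> (Suc k - 1))\<^sup>2 / \<gamma>
      - (\<theta> (Suc k - 1))\<^sup>2) ((\<theta> (Suc k))\<^sup>2 / (1 - \<gamma>) - 1) \<le> - \<epsilon>"
    using uniform_gap_of_SUP[OF assms(19)] by blast
  have gap1: "(\<theta> (Suc k))\<^sup>2 * (1 - \<theta> k)\<^sup>2 / \<gamma> \<le> (\<theta> k)\<^sup>2 - \<epsilon>"
    and gap2: "(\<theta> (Suc k))\<^sup>2 / (1 - \<gamma>) \<le> 1 - \<epsilon>" for k
    using gap[of k] by simp_all
  interpret IRL1e3_iterates \<phi> l M f gf C L \<epsilon> \<gamma> \<theta> s y z x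
    by unfold_locales (use assms M \<epsilon> gap1 gap2 in auto)
  show ?thesis
    by (rule iterates_converge[OF assms(15) assms(20)])
qed

end
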